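(* Let $\mathcal{V}$ be a finely representable action with associated complete interaction $(\mathcal{V},\mathcal{H})$, and let $(C,\sigma,U)$ be a covariant representation of $\mathcal{V}$. Then the $*$-homomorphism $\sigma\times U:\mathcal{A}\rtimes_{(\mathcal{V},\mathcal{H})}\Gamma\to C$ is injective if and only if $(C,\sigma,U)$ possesses property $( * )$.
   Context: $\mathcal{A}$ is a unital C$^*$-algebra, $\Gamma$ a totally ordered abelian group with identity $0$, $\Gamma^+=\{x\in\Gamma:0\le x\}$. An action of $\Gamma^+$ on $\mathcal{A}$ is a map $x\mapsto\mathcal{V}_x$ into the bounded positive linear maps on $\mathcal{A}$ with $\mathcal{V}_0=\mathrm{Id}$, $\mathcal{V}_x\mathcal{V}_y=\mathcal{V}_{x+y}$. A covariant representation of $\mathcal{V}$ is a triple $(C,\sigma,U)$ with $C$ a unital C$^*$-algebra, $\sigma:\mathcal{A}\to C$ a unital injective $*$-homomorphism and $U:\Gamma^+\to C$ a semigroup homomorphism with each $U_x$ a partial isometry, such that $\sigma(\mathcal{V}_x(a))=U_x\sigma(a)U_x^*$ and $U_x^*\sigma(a)U_x\in\sigma(\mathcal{A})$; $\mathcal{V}$ is finely representable if such exists. For finely representable $\mathcal{V}$ there is a unique action $\mathcal{H}$ such that $(\mathcal{V},\mathcal{H})$ is a complete interaction and $\sigma(\mathcal{H}_x(a))=U_x^*\sigma(a)U_x$ for every covariant representation. The crossed product $\mathcal{A}\rtimes_{(\mathcal{V},\mathcal{H})}\Gamma$ is the universal unital C$^*$-algebra generated by a copy of $\mathcal{A}$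 and partial isometries $\{\hat U_x\}_{x\in\Gamma^+}$ subject to $\mathcal{V}_x(a)=\hat U_xa\hat U_x^*$, $\mathcal{H}_x(a)=\hat U_x^*a\hat U_x$, $\hat U_x\hat U_y=\hat U_{x+y}$. For a covariant representation $(C,\sigma,U)$, $\sigma\times U$ denotes the unique $*$-homomorphism from the crossed product to $C$ with $(\sigma\times U)(a)=\sigma(a)$ and $(\sigma\times U)(\hat U_x)=U_x$. $C_0$ is the $*$-subalgebra generated by $\mathcal{A}$ and the $\hat U_x$. A monomial of negative (resp. positive) type is $a_1\hat U_{x_1}^*\cdots a_n\hat U_{x_n}^*$ (resp. $a_1\hat U_{x_1}\cdots a_n\hat U_{x_n}$), $a_i\in\mathcal{A}$, $x_i\in\Gamma^+$, of degree $x_1+\dots+x_n$; a quasi-monomial of degree $x$ is a finite sum of monomials of the same type, all of degree $x$. Every $b\in C_0$ can be written as $b=\sum_{x\in F}q_{-x}+b_0+\sum_{x\in F}q_x$ with $F\subseteq\Gamma^+\setminus\{0\}$ finite, $b_0\in\mathcal{A}$ and $q_{\mp x}$ quasi-monomials of negative/positive type of degree $x$; $b_0$ does not depend on the presentation, and $E_0(b):=b_0$. The covariant representation $(C,\sigma,U)$ has property $( * )$ if $\|E_0(b)\|\le\|(\sigma\times U)(b)\|$ for every $b\in C_0$. *)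

theory Defs
  imports "HOL-Analysis.Analysis"
begin

class cstar_algebra = real_normed_algebra_1 + banach +
  fixes cscale :: "complex \<Rightarrow> 'a \<Rightarrow> 'a"
    and cstar :: "'a \<Rightarrow> 'a"
  assumes cscale_of_real: "cscale (complex_of_real r) x = r *\<^sub>R x"
    and cscale_add_right: "cscale c (x + y) = cscale c x + cscale c y"
    and cscale_add_left: "cscale (c + d) x = cscale c x + cscale d x"
    and cscale_mult_scal: "cscale c (cscale d x) = cscale (c * d) x"
    and cscale_one: "cscale 1 x = x"
    and cscale_mult_left: "cscale c (x * y) = cscale c x * y"
    and cscale_mult_right: "cscale c (x * y) = x * cscale c y"
    and norm_cscale: "norm (cscale c x) = cmod c * norm x"
    and cstar_add: "cstar (x + y) = cstar x + cstar y"
    and cstar_cscale: "cstar (cscale c x) = cscale (cnj c) (cstar x)"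
    and cstar_mult: "cstar (x * y) = cstar y * cstar x"
    and cstar_cstar: "cstar (cstar x) = x"
    and cstar_identity: "norm (cstar x * x) = (norm x)\<^sup>2"

definition positive_elem :: "'a::cstar_algebra \<Rightarrow> bool" where
  "positive_elem a \<longleftrightarrow> (\<exists>x. a = cstar x * x)"

definition clinear_map :: "('a::cstar_algebra \<Rightarrow> 'b::cstar_algebra) \<Rightarrow> bool" where
  "clinear_map f \<longleftrightarrow> (\<forall>x y. f (x + y) = f x + f y) \<and> (\<forall>c x. f (cscale c x) = cscale c (f x))"

definition bounded_positive_map :: "('a::cstar_algebra \<Rightarrow> 'a) \<Rightarrow> bool" where
  "bounded_positive_map f \<longleftrightarrow> clinear_map f \<and> (\<exists>K. \<forall>x. norm (f x) \<le> K * norm x)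
     \<and> (\<forall>a. positive_elem a \<longrightarrow> positive_elem (f a))"

text \<open>An action of the positive cone of the totally ordered abelian group 'g on the C*-algebra 'a
(only the values on nonnegative elements are relevant).\<close>
definition semigroup_action :: "('g::linordered_ab_group_add \<Rightarrow> 'a::cstar_algebra \<Rightarrow> 'a) \<Rightarrow> bool" where
  "semigroup_action V \<longleftrightarrow> (\<forall>x\<ge>0. bounded_positive_map (V x)) \<and> V 0 = id
     \<and> (\<forall>x\<ge>0. \<forall>y\<ge>0. V x \<circ> V y = V (x + y))"

definition partial_isometry :: "'a::cstar_algebra \<Rightarrow> bool" where
  "partial_isometry u \<longleftrightarrow> u * cstar u * u = u"

definition unital_star_hom :: "('a::cstar_algebra \<Rightarrow> 'b::cstar_algebra) \<Rightarrow> bool" where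
  "unital_star_hom f \<longleftrightarrow> clinear_map f \<and> (\<forall>x y. f (x * y) = f x * f y)
     \<and> (\<forall>x. f (cstar x) = cstar (f x)) \<and> f 1 = 1"

definition covariant_rep ::
  "('g::linordered_ab_group_add \<Rightarrow> 'a::cstar_algebra \<Rightarrow> 'a) \<Rightarrow> ('a \<Rightarrow> 'c::cstar_algebra) \<Rightarrow> ('g \<Rightarrow> 'c) \<Rightarrow> bool" where
  "covariant_rep V \<sigma> U \<longleftrightarrow> unital_star_hom \<sigma> \<and> inj \<sigma>
     \<and> (\<forall>x\<ge>0. \<forall>y\<ge>0. U (x + y) = U x * U y)
     \<and> (\<forall>x\<ge>0. partial_isometry (U x))
     \<and> (\<forall>x\<ge>0. \<forall>a. \<sigma> (V x a) = U x * \<sigma> a * cstar (U x))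
     \<and> (\<forall>x\<ge>0. \<forall>a. cstar (U x) * \<sigma> a * U x \<in> range \<sigma>)"

inductive_set star_subalg_gen :: "'a::cstar_algebra set \<Rightarrow> 'a set" for S where
  gen: "s \<in> S \<Longrightarrow> s \<in> star_subalg_gen S"
| one: "1 \<in> star_subalg_gen S"
| add: "x \<in> star_subalg_gen S \<Longrightarrow> y \<in> star_subalg_gen S \<Longrightarrow> x + y \<in> star_subalg_gen S"
| mult: "x \<in> star_subalg_gen S \<Longrightarrow> y \<in> star_subalg_gen S \<Longrightarrow> x * y \<in> star_subalg_gen S"
| scal: "x \<in> star_subalg_gen S \<Longrightarrow> cscale c x \<in> star_subalg_gen S"
| star: "x \<in> star_subalg_gen S \<Longrightarrow> cstar x \<in> star_subalg_gen S"

definition cp_relations ::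
  "('g::linordered_ab_group_add \<Rightarrow> 'a::cstar_algebra \<Rightarrow> 'a) \<Rightarrow> ('g \<Rightarrow> 'a \<Rightarrow> 'a)
    \<Rightarrow> ('a \<Rightarrow> 'd::cstar_algebra) \<Rightarrow> ('g \<Rightarrow> 'd) \<Rightarrow> bool" where
  "cp_relations V H \<pi> S \<longleftrightarrow> unital_star_hom \<pi>
     \<and> (\<forall>x\<ge>0. partial_isometry (S x))
     \<and> (\<forall>x\<ge>0. \<forall>a. \<pi> (V x a) = S x * \<pi> a * cstar (S x))
     \<and> (\<forall>x\<ge>0. \<forall>a. \<pi> (H x a) = cstar (S x) * \<pi> a * S x)
     \<and> (\<forall>x\<ge>0. \<forall>y\<ge>0. S x * S y = S (x + y))"

text \<open>(X, iota, W) is the universal C*-algebra for these relations, where universality is required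
against all C*-algebras of the type 'd (HOL cannot quantify over all types inside a formula).\<close>
definition is_crossed_product ::
  "'d::cstar_algebra itself \<Rightarrow> ('g::linordered_ab_group_add \<Rightarrow> 'a::cstar_algebra \<Rightarrow> 'a) \<Rightarrow> ('g \<Rightarrow> 'a \<Rightarrow> 'a)
    \<Rightarrow> ('a \<Rightarrow> 'x::cstar_algebra) \<Rightarrow> ('g \<Rightarrow> 'x) \<Rightarrow> bool" where
  "is_crossed_product (T :: 'd itself) V H \<iota> W \<longleftrightarrow> cp_relations V H \<iota> W
     \<and> closure (star_subalg_gen (range \<iota> \<union> W ` {x. 0 \<le> x})) = UNIV
     \<and> (\<forall>(\<pi> :: 'a \<Rightarrow> 'd) S. cp_relations V H \<pi> S \<longrightarrow>
          (\<exists>\<phi>. unital_star_hom \<phi> \<and> (\<forall>a. \<phi> (\<iota> a) = \<pi> a) \<and> (\<forall>x\<ge>0. \<phi> (W x) = S x)))"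

definition C0 :: "('a::cstar_algebra \<Rightarrow> 'x::cstar_algebra) \<Rightarrow> ('g::linordered_ab_group_add \<Rightarrow> 'x) \<Rightarrow> 'x set" where
  "C0 \<iota> W = star_subalg_gen (range \<iota> \<union> W ` {x. 0 \<le> x})"

definition pos_monomial :: "('a::cstar_algebra \<Rightarrow> 'x::cstar_algebra) \<Rightarrow> ('g::linordered_ab_group_add \<Rightarrow> 'x)
    \<Rightarrow> 'g \<Rightarrow> 'x \<Rightarrow> bool" where
  "pos_monomial \<iota> W x m \<longleftrightarrow> (\<exists>ps. ps \<noteq> [] \<and> (\<forall>p\<in>set ps. 0 \<le> snd p)
     \<and> sum_list (map snd ps) = x \<and> m = prod_list (map (\<lambda>(a, y). \<iota> a * W y) ps))"

definition neg_monomial :: "('a::cstar_algebra \<Rightarrow> 'x::cstar_algebra) \<Rightarrow> ('g::linordered_ab_group_add \<Rightarrow> 'x)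
    \<Rightarrow> 'g \<Rightarrow> 'x \<Rightarrow> bool" where
  "neg_monomial \<iota> W x m \<longleftrightarrow> (\<exists>ps. ps \<noteq> [] \<and> (\<forall>p\<in>set ps. 0 \<le> snd p)
     \<and> sum_list (map snd ps) = x \<and> m = prod_list (map (\<lambda>(a, y). \<iota> a * cstar (W y)) ps))"

definition pos_quasi_monomial where
  "pos_quasi_monomial \<iota> W x q \<longleftrightarrow> (\<exists>ms. (\<forall>m\<in>set ms. pos_monomial \<iota> W x m) \<and> q = sum_list ms)"

definition neg_quasi_monomial where
  "neg_quasi_monomial \<iota> W x q \<longleftrightarrow> (\<exists>ms. (\<forall>m\<in>set ms. neg_monomial \<iota> W x m) \<and> q = sum_list ms)"

definition E0_presentation :: "('a::cstar_algebra \<Rightarrow> 'x::cstar_algebra) \<Rightarrow> ('g::linordered_ab_group_add \<Rightarrow> 'x)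
    \<Rightarrow> 'x \<Rightarrow> 'a \<Rightarrow> bool" where
  "E0_presentation \<iota> W b b0 \<longleftrightarrow> (\<exists>F qn qp. finite F \<and> F \<subseteq> {x. 0 < x}
     \<and> (\<forall>x\<in>F. neg_quasi_monomial \<iota> W x (qn x) \<and> pos_quasi_monomial \<iota> W x (qp x))
     \<and> b = (\<Sum>x\<in>F. qn x) + \<iota> b0 + (\<Sum>x\<in>F. qp x))"

text \<open>Property (*) of the covariant representation, phrased through the induced homomorphism phi
 = sigma x U.  Since E_0(b) does not depend on the presentation, we quantify over presentations.\<close>
definition property_star ::
  "('a::cstar_algebra \<Rightarrow> 'x::cstar_algebra) \<Rightarrow> ('g::linordered_ab_group_add \<Rightarrow> 'x) \<Rightarrow> ('x \<Rightarrow> 'c::cstar_algebra) \<Rightarrow> bool" where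
  "property_star \<iota> W \<phi> \<longleftrightarrow> (\<forall>b\<in>C0 \<iota> W. \<forall>b0. E0_presentation \<iota> W b b0 \<longrightarrow> norm b0 \<le> norm (\<phi> b))"

end

theory Submission
  imports Defs
begin

text \<open>
  Write \<open>b \<in> C\<^sub>0\<close> as a finite sum of homogeneous elements \<open>q\<^sub>y\<close>, \<open>y \<in> \<Gamma>\<close>.

  If \<open>\<phi>\<close> is injective, it is isometric, so it suffices that \<open>\<parallel>b\<^sub>0\<parallel> \<le> \<parallel>b\<parallel>\<close> in the crossed product. For every
  additive \<open>f : \<Gamma> \<rightarrow> \<real>\<close>, universality gives a (contractive) endomorphism which multiplies
  \<open>q\<^sub>y\<close> by \<open>exp (\<i> f y)\<close>. Since \<open>\<Gamma>\<close> is torsion free and \<open>\<real>\<close> is divisible, there is for every \<open>y \<noteq> 0\<close>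
  such an \<open>f\<close> with \<open>f y = 1\<close>, and Cesaro means of the powers of the endomorphism remove \<open>q\<^sub>y\<close>.

  Conversely, property (*) applied to \<open>q\<^sub>y\<^sup>* b\<close>, whose term of degree \<open>0\<close> is \<open>q\<^sub>y\<^sup>* q\<^sub>y\<close>, gives
  \<open>\<parallel>q\<^sub>y\<parallel> \<le> \<parallel>\<phi> b\<parallel>\<close>, hence \<open>\<parallel>b\<parallel> \<le> N \<parallel>\<phi> b\<parallel>\<close> if \<open>b\<close> has \<open>N\<close> components. For the powers of \<open>b\<^sup>* b\<close> the
  number \<open>N\<close> grows only polynomially because \<open>\<Gamma>\<close> is abelian, so \<open>\<parallel>b\<parallel> \<le> \<parallel>\<phi> b\<parallel>\<close> on the dense algebra \<open>C\<^sub>0\<close>.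
\<close>

section \<open>Elementary facts about C*-algebras\<close>

lemma cscale_zero_left [simp]: "cscale 0 (x::'a::cstar_algebra) = 0"
  using cscale_of_real[of 0 x] by simp

lemma cscale_sum_left: "cscale (\<Sum>i\<in>A. f i) x = (\<Sum>i\<in>A. cscale (f i) (x :: 'a::cstar_algebra))"
  by (induction A rule: infinite_finite_induct) (auto simp: cscale_add_left)

lemma cscale_eq_mult: "cscale c x = cscale c 1 * (x::'a::cstar_algebra)"
  using cscale_mult_left[of c 1 x] by simp

lemma cstar_zero [simp]: "cstar (0::'a::cstar_algebra) = 0"
  using cstar_add[of "0::'a" 0] by simp

lemma cstar_minus [simp]: "cstar (- x) = - cstar (x::'a::cstar_algebra)"
  using cstar_add[of "- x" x] by (simp add: eq_neg_iff_add_eq_0)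

lemma cstar_diff: "cstar (x - y) = cstar x - cstar (y::'a::cstar_algebra)"
  using cstar_add[of x "- y"] by simp

lemma cstar_one [simp]: "cstar (1::'a::cstar_algebra) = 1"
  by (metis cstar_cstar cstar_mult mult.left_neutral mult.right_neutral)

lemma cstar_scaleR [simp]: "cstar (r *\<^sub>R x) = r *\<^sub>R cstar (x::'a::cstar_algebra)"
  using cstar_cscale[of "complex_of_real r" x] by (simp add: cscale_of_real)

lemma cstar_power: "cstar (x ^ n) = cstar x ^ n" for x :: "'a::cstar_algebra"
  by (induction n) (simp_all add: cstar_mult power_commutes)

lemma norm_cstar [simp]: "norm (cstar x) = norm (x::'a::cstar_algebra)"
proof -
  have le: "norm y \<le> norm (cstar y)" for y :: 'a
  proof (cases "norm y = 0")
    case False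
    have "norm y * norm y \<le> norm (cstar y) * norm y"
      using norm_mult_ineq[of "cstar y" y] by (simp add: cstar_identity power2_eq_square)
    then show ?thesis using False by simp
  qed simp
  show ?thesis using le[of x] le[of "cstar x"] by (simp add: cstar_cstar)
qed

lemma bounded_linear_cstar: "bounded_linear (cstar :: 'a::cstar_algebra \<Rightarrow> 'a)"
  by (rule bounded_linear_intro[of _ 1]) (simp_all add: cstar_add)

lemma norm_power2_selfadjoint:
  "cstar a = a \<Longrightarrow> norm (a\<^sup>2) = (norm a)\<^sup>2" for a :: "'a::cstar_algebra"
  using cstar_identity[of a] by (simp add: power2_eq_square)

text \<open>Iterating the C*-identity yields the exponents \<open>2 ^ n\<close>; the growth argument
  at the end therefore uses these powers alone.\<close>

lemma norm_power_selfadjoint: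
  "cstar a = a \<Longrightarrow> norm (a ^ (2 ^ n)) = norm a ^ (2 ^ n)" for a :: "'a::cstar_algebra"
proof (induction n)
  case (Suc n)
  have "norm ((a ^ (2 ^ n))\<^sup>2) = (norm (a ^ (2 ^ n)))\<^sup>2"
    by (rule norm_power2_selfadjoint) (simp add: cstar_power Suc.prems)
  then show ?case using Suc by (simp add: power_mult[symmetric] mult.commute)
qed simp

text \<open>If \<open>x\<^sup>2 + y\<^sup>2 = r\<close>, then \<open>x + \<i> y\<close> is \<open>\<surd>r\<close> times a unitary with real part \<open>x / \<surd>r\<close>.\<close>

lemma norm_le_of_squares_sum:
  fixes x y :: "'a::cstar_algebra"
  assumes "cstar x = x" "cstar y = y" "x * y = y * x" "x * x + y * y = r *\<^sub>R 1"
  shows "(norm x)\<^sup>2 \<le> \<bar>r\<bar>"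
proof -
  define u where "u = x + cscale \<i> y"
  have su: "cstar u = x - cscale \<i> y"
  proof -
    have "cscale (- \<i>) y = - cscale \<i> y"
      using cscale_add_left[of "-\<i>" \<i> y] by (simp add: eq_neg_iff_add_eq_0)
    then show ?thesis by (simp add: u_def cstar_add cstar_cscale assms)
  qed
  have iy: "cscale \<i> y * cscale \<i> y = - (y * y)"
  proof -
    have "cscale \<i> y * cscale \<i> y = cscale (complex_of_real (-1)) (y * y)"
      by (simp add: cscale_mult_left[symmetric] cscale_mult_right[symmetric] cscale_mult_scal)
    also have "\<dots> = - (y * y)"
      unfolding cscale_of_real by simp
    finally show ?thesis .
  qed
  have xy: "x * cscale \<i> y = cscale \<i> y * x"
    by (simp add: cscale_mult_left[symmetric] cscale_mult_right[symmetric] assms(3))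
  have "cstar u * u = r *\<^sub>R 1"
    unfolding su unfolding u_def using assms(4) iy xy by (simp add: algebra_simps)
  then have nu: "(norm u)\<^sup>2 = \<bar>r\<bar>"
    using cstar_identity[of u] by simp
  have "2 *\<^sub>R x = u + cstar u"
    unfolding su unfolding u_def by (simp add: scaleR_2)
  then have "2 * norm x \<le> norm u + norm u"
    using norm_triangle_ineq[of u "cstar u"] by (metis norm_cstar norm_scaleR abs_numeral)
  then have "norm x \<le> norm u" by simp
  then show ?thesis using nu by (metis norm_ge_zero power_mono)
qed

section \<open>Square roots\<close>

text \<open>Taylor coefficients of sqrt(1 - t) at t = 0.\<close>

definition sqrt_coeff :: "nat \<Rightarrow> real" where
  "sqrt_coeff n = (-1) ^ n * ((1/2) gchoose n)"

text \<open>The binomial series of \<open>\<surd>(1 - d)\<close>; it is only meaningful for \<open>norm d \<le> 1\<close>.\<close>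

definition sqrt_one_minus :: "'a::cstar_algebra \<Rightarrow> 'a" where
  "sqrt_one_minus d = (\<Sum>n. sqrt_coeff n *\<^sub>R d ^ n)"

lemma sqrt_coeff_0 [simp]: "sqrt_coeff 0 = 1"
  by (simp add: sqrt_coeff_def)

text \<open>This number is both a Taylor coefficient of (1 - t)^(-1/2) and the partial sum of
  \<open>sqrt_coeff\<close> up to \<open>m\<close>, so its sign controls those partial sums.
  Consecutive values have the ratio (m + 1/2) / (m + 1).\<close>

lemma gbinomial_minus_half_sign: "(-1) ^ m * ((- 1/2 :: real) gchoose m) > 0"
proof (induction m)
  case (Suc m)
  have "real (Suc m) * ((- 1/2) gchoose Suc m) = (- 1/2 - real m) * ((- 1/2) gchoose m)"
    using gbinomial_absorb_comp[of "- 1/2 :: real" m] gbinomial_absorption[of m "- 1/2 :: real"]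
    by simp
  then have "real (Suc m) * ((-1) ^ Suc m * ((- 1/2 :: real) gchoose Suc m))
      = (-1) ^ Suc m * ((- 1/2 - real m) * ((- 1/2) gchoose m))"
    by (metis mult.left_commute)
  also have "\<dots> = (1/2 + real m) * ((-1) ^ m * ((- 1/2 :: real) gchoose m))"
    by (simp add: algebra_simps)
  also have "\<dots> > 0" using Suc by simp
  finally show ?case by (rule zero_less_mult_pos) simp
qed simp

lemma sqrt_coeff_Suc_neg: "sqrt_coeff (Suc n) < 0"
proof -
  have "real (Suc n) * ((1/2) gchoose Suc n) = 1/2 * ((- 1/2) gchoose n)"
    using gbinomial_absorption[of n "1/2 :: real"] by simp
  then have "real (Suc n) * sqrt_coeff (Suc n) = (-1) ^ Suc n * (1/2 * ((- 1/2) gchoose n))"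
    unfolding sqrt_coeff_def by (metis mult.left_commute)
  also have "\<dots> = - 1/2 * ((-1) ^ n * ((- 1/2) gchoose n))"
    by simp
  also have "\<dots> < 0" using gbinomial_minus_half_sign[of n] by simp
  finally show ?thesis by (simp add: mult_less_0_iff)
qed

lemma sum_sqrt_coeff: "(\<Sum>k\<le>m. sqrt_coeff k) = (-1) ^ m * ((- 1/2) gchoose m)"
  using gbinomial_sum_lower_neg[of "1/2 :: real" m]
  by (simp add: sqrt_coeff_def mult.commute)

text \<open>All coefficients after the zeroth are negative, so their absolute values add up to 1
  minus a positive partial sum. The series thus converges absolutely on the closed unit ball,
  boundary included.\<close>

lemma sum_abs_sqrt_coeff_Suc: "(\<Sum>k<m. \<bar>sqrt_coeff (Suc k)\<bar>) \<le> 1"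
proof -
  have "(\<Sum>k\<le>m. sqrt_coeff k) = 1 + (\<Sum>k<m. sqrt_coeff (Suc k))"
    using sum.lessThan_Suc_shift[of sqrt_coeff m] by (simp add: lessThan_Suc_atMost)
  moreover have "(\<Sum>k<m. \<bar>sqrt_coeff (Suc k)\<bar>) = - (\<Sum>k<m. sqrt_coeff (Suc k))"
    unfolding sum_negf[symmetric]
    by (intro sum.cong) (use sqrt_coeff_Suc_neg in \<open>auto simp: abs_if\<close>)
  ultimately show ?thesis
    using sum_sqrt_coeff[of m] gbinomial_minus_half_sign[of m] by simp
qed

lemma summable_abs_sqrt_coeff_Suc: "summable (\<lambda>k. \<bar>sqrt_coeff (Suc k)\<bar>)"
  by (rule summableI_nonneg_bounded[of _ 1]) (use sum_abs_sqrt_coeff_Suc in auto)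

context
  fixes d :: "'a::cstar_algebra"
  assumes d: "norm d \<le> 1"
begin

lemma norm_sqrt_term: "norm (sqrt_coeff n *\<^sub>R d ^ n) \<le> \<bar>sqrt_coeff n\<bar>"
proof -
  have "norm (d ^ n) \<le> 1"
    using norm_power_ineq[of d n] power_le_one[of "norm d" n] d by simp
  then show ?thesis by (simp add: mult_left_le)
qed

lemma summable_norm_sqrt_terms: "summable (\<lambda>n. norm (sqrt_coeff n *\<^sub>R d ^ n))"
proof -
  have "summable (\<lambda>n. \<bar>sqrt_coeff n\<bar>)"
    using summable_abs_sqrt_coeff_Suc summable_Suc_iff[of "\<lambda>n. \<bar>sqrt_coeff n\<bar>"] by simp
  then show ?thesis
    by (rule summable_comparison_test') (use norm_sqrt_term in auto)
qed

lemma summable_sqrt_terms: "summable (\<lambda>n. sqrt_coeff n *\<^sub>R d ^ n)"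
  by (rule summable_norm_cancel[OF summable_norm_sqrt_terms])

text \<open>In the Cauchy product, Vandermonde's identity with 1/2 + 1/2 = 1 turns the coefficients
  into those of the polynomial 1 - t.\<close>

lemma sqrt_one_minus_square: "sqrt_one_minus d * sqrt_one_minus d = 1 - d"
proof -
  have coeff: "(\<Sum>i\<le>k. sqrt_coeff i * sqrt_coeff (k - i)) = (-1) ^ k * (1 gchoose k)" for k
  proof -
    have "(\<Sum>i\<le>k. sqrt_coeff i * sqrt_coeff (k - i))
        = (\<Sum>i\<le>k. (-1) ^ k * (((1/2) gchoose i) * ((1/2) gchoose (k - i))))"
      by (intro sum.cong refl) (simp add: sqrt_coeff_def flip: power_add)
    also have "\<dots> = (-1) ^ k * ((1/2 + 1/2) gchoose k)"
      by (simp only: sum_distrib_left[symmetric] gbinomial_Vandermonde atMost_atLeast0)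
    finally show ?thesis by simp
  qed
  have "sqrt_one_minus d * sqrt_one_minus d
      = (\<Sum>k. \<Sum>i\<le>k. (sqrt_coeff i *\<^sub>R d ^ i) * (sqrt_coeff (k - i) *\<^sub>R d ^ (k - i)))"
    unfolding sqrt_one_minus_def
    by (rule Cauchy_product[OF summable_norm_sqrt_terms summable_norm_sqrt_terms])
  also have "\<dots> = (\<Sum>k. ((-1) ^ k * (1 gchoose k)) *\<^sub>R d ^ k)"
    unfolding coeff[symmetric] scaleR_sum_left
    by (intro suminf_cong sum.cong refl) (simp flip: power_add)
  also have "\<dots> = (\<Sum>k\<in>{0,1}. ((-1) ^ k * (1 gchoose k)) *\<^sub>R d ^ k)"
  proof (rule suminf_finite)
    fix k :: nat assume "k \<notin> {0, 1}"
    then have "(1::real) gchoose k = 0"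
      using binomial_gbinomial[of 1 k, where 'a = real] by (cases k) (auto simp: binomial_eq_0)
    then show "((-1) ^ k * (1 gchoose k)) *\<^sub>R d ^ k = 0" by simp
  qed simp
  also have "\<dots> = 1 - d" by simp
  finally show ?thesis .
qed

lemma cstar_sqrt_one_minus: "cstar d = d \<Longrightarrow> cstar (sqrt_one_minus d) = sqrt_one_minus d"
  unfolding sqrt_one_minus_def bounded_linear.suminf[OF bounded_linear_cstar summable_sqrt_terms]
  by (simp add: cstar_power)

lemma sqrt_one_minus_commute:
  assumes "d * z = z * d"
  shows "sqrt_one_minus d * z = z * sqrt_one_minus d"
proof -
  have "d ^ n * z = z * d ^ n" for n
    using power_commuting_commutes[of d z n] assms by simp
  then show ?thesis
    unfolding sqrt_one_minus_def
      suminf_mult[OF summable_sqrt_terms, symmetric] suminf_mult2[OF summable_sqrt_terms]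
    by simp
qed

text \<open>Allows a second root: for \<open>m = sqrt_one_minus d\<close> the element
  \<open>1 - m\<close> is again in the unit ball, so \<open>sqrt_one_minus (1 - m)\<close> is a
  square root of \<open>m\<close>.\<close>

lemma norm_one_minus_sqrt_one_minus: "norm (1 - sqrt_one_minus d) \<le> 1"
proof -
  have "sqrt_one_minus d = (\<Sum>n. sqrt_coeff (Suc n) *\<^sub>R d ^ Suc n) + 1"
    unfolding sqrt_one_minus_def using suminf_split_head[OF summable_sqrt_terms]
    by (simp del: power_Suc)
  then have "norm (1 - sqrt_one_minus d) = norm (\<Sum>n. sqrt_coeff (Suc n) *\<^sub>R d ^ Suc n)"
    by simp
  also have "\<dots> \<le> (\<Sum>n. \<bar>sqrt_coeff (Suc n)\<bar>)"
    using summable_abs_sqrt_coeff_Suc by (rule norm_suminf_le[OF norm_sqrt_term])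
  also have "\<dots> \<le> 1"
    by (rule suminf_le_const[OF summable_abs_sqrt_coeff_Suc sum_abs_sqrt_coeff_Suc])
  finally show ?thesis .
qed

end

text \<open>Makes \<open>sqrt_one_minus (1 - h * h)\<close> available as the absolute value of
  \<open>h\<close>. The root \<open>s\<close> of \<open>1 - h * h\<close> satisfies s^2 + h^2 = 1,
  which bounds its norm by 1.\<close>

lemma norm_one_minus_square_le:
  fixes h :: "'a::cstar_algebra"
  assumes "cstar h = h" "norm h \<le> 1"
  shows "norm (1 - h * h) \<le> 1"
proof -
  have n: "norm (h * h) \<le> 1"
    using norm_mult_ineq[of h h] assms(2) mult_le_one[of "norm h" "norm h"] by simp
  define s where "s = sqrt_one_minus (h * h)"
  have s: "cstar s = s" "s * h = h * s" "s * s = 1 - h * h"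
    unfolding s_def
    by (simp_all add: cstar_sqrt_one_minus[OF n] sqrt_one_minus_commute[OF n]
        sqrt_one_minus_square[OF n] cstar_mult assms(1) mult.assoc)
  have "(norm s)\<^sup>2 \<le> \<bar>1\<bar>"
    by (rule norm_le_of_squares_sum[of s h 1]) (use s assms in auto)
  then show ?thesis using norm_power2_selfadjoint[OF s(1)] s(3) by (simp add: power2_eq_square)
qed

text \<open>Positivity is expressed by being the square of a self-adjoint element, which avoids
  spectral theory. For the difference \<open>d\<close> of \<open>s * s\<close> and
  \<open>t * t\<close>, equality of the squares gives (s^2 + t^2) d = 0. Hence (s d)^2 + (t d)^2 =
  0, so s d and t d vanish, and d^2 = 0.\<close>

lemma positive_square_roots_unique:
  fixes s t :: "'a::cstar_algebra"
  assumes s: "cstar s = s" and t: "cstar t = t" and st: "s * t = t * s"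
    and eq: "(s * s) * (s * s) = (t * t) * (t * t)"
  shows "s * s = t * t"
proof -
  define m k where "m = s * s" and "k = t * t"
  define d where "d = m - k"
  have comm: "s * m = m * s" "s * k = k * s" "t * m = m * t" "t * k = k * t" "m * k = k * m"
    unfolding m_def k_def by (metis mult.assoc st)+
  have d: "cstar d = d" "s * d = d * s" "t * d = d * t"
    unfolding d_def using comm by (auto simp: cstar_diff m_def k_def cstar_mult s t algebra_simps)
  have md: "(m + k) * d = 0"
    unfolding d_def using comm(5) eq by (simp add: algebra_simps m_def k_def)
  have sd2: "(s * d) * (s * d) = m * d * d"
    by (metis d(2) m_def mult.assoc)
  have td2: "(t * d) * (t * d) = k * d * d"
    by (metis d(3) k_def mult.assoc)
  have sum0: "(s * d) * (s * d) + (t * d) * (t * d) = 0 *\<^sub>R 1"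
  proof -
    have "(s * d) * (s * d) + (t * d) * (t * d) = ((m + k) * d) * d"
      unfolding sd2 td2 by (simp add: algebra_simps)
    then show ?thesis using md by simp
  qed
  have sa: "cstar (s * d) = s * d" "cstar (t * d) = t * d"
    using d s t by (simp_all add: cstar_mult)
  have c: "(s * d) * (t * d) = (t * d) * (s * d)"
    by (metis d(2) d(3) mult.assoc st)
  have "s * d = 0"
    using norm_le_of_squares_sum[OF sa c sum0] by simp
  moreover have "t * d = 0"
    using norm_le_of_squares_sum[OF sa(2,1) c[symmetric]] sum0 by (simp add: add.commute)
  ultimately have "m * d = 0" "k * d = 0"
    unfolding m_def k_def by (simp_all add: mult.assoc)
  then have "d * d = 0" unfolding d_def by (metis left_diff_distrib diff_zero)
  then have "d = 0" using cstar_identity[of d] d(1) by simp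
  then show ?thesis by (simp add: d_def m_def k_def)
qed

section \<open>Star homomorphisms\<close>

context
  fixes f :: "'a::cstar_algebra \<Rightarrow> 'b::cstar_algebra"
  assumes hom: "unital_star_hom f"
begin

lemma star_hom_add: "f (x + y) = f x + f y"
  and star_hom_mult: "f (x * y) = f x * f y"
  and star_hom_cstar: "f (cstar x) = cstar (f x)"
  and star_hom_one: "f 1 = 1"
  and star_hom_cscale: "f (cscale c x) = cscale c (f x)"
  using hom by (auto simp: unital_star_hom_def clinear_map_def)

lemma star_hom_scaleR: "f (r *\<^sub>R x) = r *\<^sub>R f x"
  using star_hom_cscale[of "complex_of_real r" x] by (simp add: cscale_of_real)

lemma star_hom_zero: "f 0 = 0"
  using star_hom_add[of 0 0] by simp

lemma star_hom_diff: "f (x - y) = f x - f y"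
  using star_hom_add[of "x - y" y] by simp

lemma star_hom_power: "f (x ^ n) = f x ^ n"
  by (induction n) (simp_all add: star_hom_one star_hom_mult)

lemma star_hom_sum: "f (\<Sum>i\<in>A. g i) = (\<Sum>i\<in>A. f (g i))"
  by (induction A rule: infinite_finite_induct) (simp_all add: star_hom_zero star_hom_add)

text \<open>A self-adjoint \<open>a\<close> in the unit ball has a partner \<open>s\<close> with a^2
  + s^2 = 1. The homomorphism preserves this relation, which bounds the norm of \<open>f a\<close>;
  scaling and the C*-identity do the rest.\<close>

lemma star_hom_norm_le: "norm (f x) \<le> norm x"
proof -
  have unit: "norm (f a) \<le> 1" if "cstar a = a" "norm a \<le> 1" for a
  proof -
    have n: "norm (a * a) \<le> 1"
      using norm_mult_ineq[of a a] that mult_le_one[of "norm a" "norm a"] by simp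
    define s where "s = sqrt_one_minus (a * a)"
    have s: "cstar s = s" "s * a = a * s" "s * s = 1 - a * a"
      unfolding s_def
      by (simp_all add: cstar_sqrt_one_minus[OF n] sqrt_one_minus_commute[OF n]
          sqrt_one_minus_square[OF n] cstar_mult that mult.assoc)
    have "(norm (f a))\<^sup>2 \<le> \<bar>1\<bar>"
    proof (rule norm_le_of_squares_sum[of _ "f s"])
      show "f a * f a + f s * f s = 1 *\<^sub>R 1"
        using s(3) by (simp add: star_hom_one flip: star_hom_mult star_hom_add)
    qed (use s that in \<open>simp_all flip: star_hom_cstar star_hom_mult\<close>)
    then show ?thesis by (simp add: abs_square_le_1)
  qed
  have selfadj: "norm (f a) \<le> norm a" if a: "cstar a = a" for a
  proof (cases "a = 0")
    case False
    have "norm (f ((1 / norm a) *\<^sub>R a)) \<le> 1"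
      by (rule unit) (use a False in auto)
    then show ?thesis using False by (simp add: star_hom_scaleR divide_simps split: if_splits)
  qed (simp add: star_hom_zero)
  have "(norm (f x))\<^sup>2 = norm (f (cstar x * x))"
    by (simp add: star_hom_mult star_hom_cstar cstar_identity)
  also have "\<dots> \<le> norm (cstar x * x)"
    by (rule selfadj) (simp add: cstar_mult cstar_cstar)
  finally show ?thesis unfolding cstar_identity by (rule power2_le_imp_le) simp
qed

lemma bounded_linear_star_hom: "bounded_linear f"
  by (rule bounded_linear_intro[of _ 1]) (simp_all add: star_hom_add star_hom_scaleR star_hom_norm_le)

text \<open>With \<open>r = \<parallel>f a\<parallel>\<^sup>2\<close> and \<open>h = a\<^sup>2 - r\<close>, the element \<open>\<bar>h\<bar> + h\<close> is in the kernel of \<open>f\<close>, because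
  \<open>f h \<le> 0\<close>. Hence \<open>r - a\<^sup>2 = \<bar>h\<bar> \<ge> 0\<close>.\<close>

lemma injective_star_hom_norm_ge:
  assumes inj: "inj f"
  shows "norm x \<le> norm (f x)"
proof -
  \<comment> \<open>The constant 1/2 bounds the norm of \<open>a * a\<close> and also
    \<open>r\<close>, so that \<open>h\<close> lies in the unit ball, where its absolute value can
    be formed.\<close>
  have small: "norm a \<le> norm (f a)" if a: "cstar a = a" and na: "(norm a)\<^sup>2 \<le> 1/2" for a
  proof (cases "f a = 0")
    case True
    then have "a = 0" using inj star_hom_zero by (metis injD)
    then show ?thesis by simp
  next
    case False
    define r where "r = (norm (f a))\<^sup>2"
    have "r \<le> (norm a)\<^sup>2" unfolding r_def by (rule power_mono) (simp_all add: star_hom_norm_le)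
    then have r: "0 < r" "r \<le> 1/2"
      using False na by (simp add: r_def, linarith)
    define h where "h = a * a - r *\<^sub>R 1"
    have h: "cstar h = h" by (simp add: h_def cstar_diff cstar_mult a)
    have "norm h \<le> norm (a * a) + norm (r *\<^sub>R (1::'a))"
      unfolding h_def by (rule norm_triangle_ineq4)
    also have "\<dots> \<le> 1"
      using na r norm_power2_selfadjoint[OF a] by (simp add: power2_eq_square)
    finally have nh: "norm h \<le> 1" .
    note nh1 = norm_one_minus_square_le[OF h nh]
    \<comment> \<open>\<open>m\<close> is the absolute value of \<open>h\<close>; its root
      \<open>s\<close> below exhibits it as positive.\<close>
    define m where "m = sqrt_one_minus (1 - h * h)"
    have m: "cstar m = m" "m * m = h * h" "norm (1 - m) \<le> 1"
      unfolding m_def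
      by (simp_all add: cstar_sqrt_one_minus[OF nh1] sqrt_one_minus_square[OF nh1]
          norm_one_minus_sqrt_one_minus[OF nh1] cstar_diff cstar_mult h)
    have ma: "m * a = a * m"
      unfolding m_def by (rule sqrt_one_minus_commute[OF nh1]) (simp add: h_def algebra_simps)
    define s where "s = sqrt_one_minus (1 - m)"
    have s: "cstar s = s" "s * s = m"
      unfolding s_def
      by (simp_all add: cstar_sqrt_one_minus[OF m(3)] sqrt_one_minus_square[OF m(3)] cstar_diff m)
    have sa: "s * a = a * s"
      unfolding s_def by (rule sqrt_one_minus_commute[OF m(3)]) (simp add: ma algebra_simps)
    \<comment> \<open>Since \<open>e\<close> is f(a)^2 divided by its norm, r (1 - e) has a root
      \<open>t\<close>, which exhibits \<open>- f h\<close> as positive.\<close>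
    define e where "e = (1 / r) *\<^sub>R (f a * f a)"
    have fa: "cstar (f a) = f a" using a by (simp flip: star_hom_cstar)
    have ne: "norm e \<le> 1"
      using norm_power2_selfadjoint[OF fa] r by (simp add: e_def r_def power2_eq_square)
    define t where "t = sqrt r *\<^sub>R sqrt_one_minus e"
    have t: "cstar t = t"
      unfolding t_def cstar_scaleR
      by (subst cstar_sqrt_one_minus[OF ne]) (simp_all add: e_def cstar_mult fa)
    have tt: "t * t = - f h"
    proof -
      have "t * t = r *\<^sub>R (sqrt_one_minus e * sqrt_one_minus e)"
        using r by (simp add: t_def)
      also have "\<dots> = r *\<^sub>R 1 - f a * f a"
        unfolding sqrt_one_minus_square[OF ne] using r by (simp add: e_def algebra_simps)
      finally show ?thesis
        by (simp add: h_def star_hom_diff star_hom_mult star_hom_scaleR star_hom_one)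
    qed
    have fs_fa: "f s * f a = f a * f s"
      using sa by (metis star_hom_mult)
    have "e * f s = f s * e"
      unfolding e_def using fs_fa by (simp, metis mult.assoc)
    then have "f s * t = t * f s"
      unfolding t_def using sqrt_one_minus_commute[OF ne, of "f s"] by simp
    \<comment> \<open>\<open>f m\<close> and \<open>- f h\<close> are commuting positive elements
      with the same square.\<close>
    then have "f s * f s = t * t"
    proof (rule positive_square_roots_unique[rotated 2])
      show "cstar (f s) = f s" using s by (simp flip: star_hom_cstar)
      show "(f s * f s) * (f s * f s) = t * t * (t * t)"
        unfolding tt using s m by (simp flip: star_hom_mult)
    qed (rule t)
    then have "f m = - f h" unfolding tt using s by (simp flip: star_hom_mult)
    then have "f (m + h) = f 0" by (simp add: star_hom_add star_hom_zero)
    then have "m + h = 0" using inj by (rule injD[rotated])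
    then have "a * a + s * s = r *\<^sub>R 1"
      unfolding s(2) h_def by (simp add: algebra_simps)
    then have "(norm a)\<^sup>2 \<le> \<bar>r\<bar>"
      by (intro norm_le_of_squares_sum[of a s r]) (use a s sa in auto)
    then have "(norm a)\<^sup>2 \<le> (norm (f a))\<^sup>2" by (simp add: r_def)
    then show ?thesis by (rule power2_le_imp_le) simp
  qed
  have selfadj: "norm a \<le> norm (f a)" if a: "cstar a = a" for a
  proof (cases "a = 0")
    case False
    have "norm ((1 / (2 * norm a)) *\<^sub>R a) \<le> norm (f ((1 / (2 * norm a)) *\<^sub>R a))"
      by (rule small) (use a False in \<open>auto simp: power2_eq_square\<close>)
    then show ?thesis using False by (simp add: star_hom_scaleR divide_simps split: if_splits)
  qed simp
  have "(norm x)\<^sup>2 \<le> norm (f (cstar x * x))"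
    using selfadj[of "cstar x * x"] by (simp add: cstar_mult cstar_cstar cstar_identity)
  also have "\<dots> = (norm (f x))\<^sup>2"
    by (simp add: star_hom_mult star_hom_cstar cstar_identity)
  finally show ?thesis by (rule power2_le_imp_le) simp
qed

end

section \<open>Additive functionals on ordered groups\<close>

primrec nat_mult :: "nat \<Rightarrow> 'g::ab_group_add \<Rightarrow> 'g" where
  "nat_mult 0 x = 0"
| "nat_mult (Suc n) x = x + nat_mult n x"

lemma nat_mult_add_left: "nat_mult (m + n) x = nat_mult m x + nat_mult n x"
  by (induction m) (simp_all add: algebra_simps)

lemma nat_mult_mult: "nat_mult (m * n) x = nat_mult m (nat_mult n x)"
  by (induction m) (simp_all add: nat_mult_add_left)

text \<open>The order excludes torsion: sums of positive elements stay positive, and a sign change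
  handles negative ones.\<close>

lemma nat_mult_eq_0_iff:
  fixes x :: "'g::linordered_ab_group_add"
  assumes "x \<noteq> 0"
  shows "nat_mult n x = 0 \<longleftrightarrow> n = 0"
proof -
  have pos: "0 < nat_mult (Suc k) z" if "0 < z" for k and z :: 'g
    using that by (induction k) (simp_all add: add_pos_pos)
  have neg: "nat_mult k (- z) = - nat_mult k z" for k and z :: 'g
    by (induction k) simp_all
  show ?thesis
  proof (cases n)
    case (Suc k)
    consider "0 < x" | "0 < - x" using assms by fastforce
    then have "nat_mult n x \<noteq> 0"
    proof cases
      case 1
      then show ?thesis using pos[of x k] Suc by simp
    next
      case 2
      then have "0 < - nat_mult n x" using pos[of "- x" k] by (simp only: neg Suc)
      then show ?thesis by auto
    qed
    then show ?thesis using Suc by simp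
  qed simp
qed

text \<open>Such a \<open>G\<close> is the graph of an additive real-valued map on a subgroup:
  closure under differences gives a subgroup of the product, and the condition at 0 makes it
  single-valued. For graphs, extension is inclusion, as suits Zorn's lemma.\<close>

definition is_partial_functional :: "'g::ab_group_add \<Rightarrow> ('g \<times> real) set \<Rightarrow> bool" where
  "is_partial_functional y G \<longleftrightarrow> (y, 1) \<in> G \<and> (\<forall>r. (0, r) \<in> G \<longrightarrow> r = 0)
     \<and> (\<forall>a r b s. (a, r) \<in> G \<longrightarrow> (b, s) \<in> G \<longrightarrow> (a - b, r - s) \<in> G)"

context
  fixes y :: "'g::linordered_ab_group_add" and G
  assumes G: "is_partial_functional y G"
begin

lemma partial_functional_diff: "(a, r) \<in> G \<Longrightarrow> (b, s) \<in> G \<Longrightarrow> (a - b, r - s) \<in> G"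
  using G unfolding is_partial_functional_def by blast

lemma partial_functional_zero: "(0, 0) \<in> G"
  using G partial_functional_diff[of y 1 y 1] unfolding is_partial_functional_def by simp

lemma partial_functional_minus: "(a, r) \<in> G \<Longrightarrow> (- a, - r) \<in> G"
  using partial_functional_diff[OF partial_functional_zero] by force

lemma partial_functional_add: "(a, r) \<in> G \<Longrightarrow> (b, s) \<in> G \<Longrightarrow> (a + b, r + s) \<in> G"
  using partial_functional_diff[of a r "- b" "- s"] partial_functional_minus by simp

lemma partial_functional_nat_mult: "(a, r) \<in> G \<Longrightarrow> (nat_mult n a, real n * r) \<in> G"
  by (induction n) (auto simp: partial_functional_zero algebra_simps intro: partial_functional_add)

lemma partial_functional_unique: "(a, r) \<in> G \<Longrightarrow> (a, s) \<in> G \<Longrightarrow> r = s"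
  using partial_functional_diff[of a r a s] G unfolding is_partial_functional_def by auto

text \<open>It suffices to find a value \<open>s\<close> at \<open>x\<close> compatible with all
  multiples of \<open>x\<close> already in the domain; division in the reals supplies it.\<close>

lemma partial_functional_extend: "\<exists>G'. is_partial_functional y G' \<and> G \<subseteq> G' \<and> (\<exists>s. (x, s) \<in> G')"
proof -
  obtain s where s: "\<And>n r. (nat_mult n x, r) \<in> G \<Longrightarrow> r = real n * s"
  proof (cases "\<exists>m \<rho>. m > 0 \<and> (nat_mult m x, \<rho>) \<in> G")
    case True
    then obtain m \<rho> where m: "m > 0" "(nat_mult m x, \<rho>) \<in> G" by blast
    have "r = real n * (\<rho> / real m)" if "(nat_mult n x, r) \<in> G" for n r
    proof -
      have "(nat_mult (n * m) x, real n * \<rho>) \<in> G"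
        using partial_functional_nat_mult[OF m(2)] by (simp add: nat_mult_mult)
      moreover have "(nat_mult (n * m) x, real m * r) \<in> G"
        using partial_functional_nat_mult[OF that, of m] by (simp add: nat_mult_mult mult.commute)
      ultimately have "real n * \<rho> = real m * r" by (rule partial_functional_unique)
      then show ?thesis using m by (simp add: field_simps)
    qed
    then show ?thesis by (rule that)
  next
    case False
    \<comment> \<open>No positive multiple of \<open>x\<close> lies in the domain, so any value
      would do, and 0 is taken.\<close>
    have "r = real n * 0" if nr: "(nat_mult n x, r) \<in> G" for n r
    proof -
      have "n = 0"
      proof (rule ccontr)
        assume "n \<noteq> 0"
        with nr have "n > 0 \<and> (nat_mult n x, r) \<in> G" by simp
        then have "\<exists>m \<rho>. m > 0 \<and> (nat_mult m x, \<rho>) \<in> G" by (intro exI)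
        with False show False by (rule notE)
      qed
      then have "(0, r) \<in> G" using nr by simp
      then show ?thesis using partial_functional_unique[OF _ partial_functional_zero] by simp
    qed
    then show ?thesis by (rule that)
  qed
  \<comment> \<open>The sum of \<open>G\<close> and the integer multiples of \<open>(x, s)\<close>;
    integers appear as differences of \<open>i\<close> and \<open>j\<close>.\<close>
  define G' where "G' = {(g + nat_mult i x - nat_mult j x, r + real i * s - real j * s) | g r i j.
    (g, r) \<in> G}"
  have G'I: "(g + nat_mult i x - nat_mult j x, r + real i * s - real j * s) \<in> G'"
    if "(g, r) \<in> G" for g r i j
    using that unfolding G'_def by blast
  have sub: "G \<subseteq> G'"
  proof
    fix p assume "p \<in> G"
    then show "p \<in> G'" using G'I[of "fst p" "snd p" 0 0] by simp
  qed
  have "is_partial_functional y G'"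
    unfolding is_partial_functional_def
  proof (intro conjI allI impI)
    show "(y, 1) \<in> G'" using sub G unfolding is_partial_functional_def by blast
  next
    fix t assume "(0, t) \<in> G'"
    then obtain g r i j where g: "(g, r) \<in> G" "0 = g + nat_mult i x - nat_mult j x"
      "t = r + real i * s - real j * s" unfolding G'_def by auto
    show "t = 0"
    proof (cases "i \<le> j")
      case True
      then have "g = nat_mult (j - i) x"
        using g(2) nat_mult_add_left[of "j - i" i x] by (simp add: algebra_simps)
      then have "r = real (j - i) * s" using g(1) s by blast
      then show ?thesis using g(3) True by (simp add: of_nat_diff algebra_simps)
    next
      case False
      then have "g + nat_mult (i - j) x = 0"
        using g(2) nat_mult_add_left[of "i - j" j x] by (simp add: algebra_simps)
      then have "- g = nat_mult (i - j) x" by (rule minus_unique)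
      then have "- r = real (i - j) * s" using partial_functional_minus[OF g(1)] s by metis
      then show ?thesis using g(3) False by (simp add: of_nat_diff algebra_simps)
    qed
  next
    fix a r b u assume "(a, r) \<in> G'" "(b, u) \<in> G'"
    then obtain g p i j g' p' i' j' where
      1: "(g, p) \<in> G" "a = g + nat_mult i x - nat_mult j x" "r = p + real i * s - real j * s" and
      2: "(g', p') \<in> G" "b = g' + nat_mult i' x - nat_mult j' x" "u = p' + real i' * s - real j' * s"
      unfolding G'_def by auto
    have "a - b = (g - g') + nat_mult (i + j') x - nat_mult (j + i') x"
      "r - u = (p - p') + real (i + j') * s - real (j + i') * s"
      unfolding 1(2,3) 2(2,3) by (simp_all add: nat_mult_add_left algebra_simps)
    then show "(a - b, r - u) \<in> G'"
      using G'I[OF partial_functional_diff[OF 1(1) 2(1)]] by metis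
  qed
  moreover have "(x, s) \<in> G'"
    using G'I[OF partial_functional_zero, of 1 0] by simp
  ultimately show ?thesis using sub by blast
qed

end

text \<open>A maximal graph has full domain by \<open>partial_functional_extend\<close>. This is the
  injectivity of the divisible group of reals, applied to the cyclic group generated by
  \<open>y\<close>.\<close>

lemma exists_additive_functional:
  fixes y :: "'g::linordered_ab_group_add"
  assumes "y \<noteq> 0"
  obtains f :: "'g \<Rightarrow> real" where "\<forall>a b. f (a + b) = f a + f b" and "f y = 1"
proof -
  let ?A = "Collect (is_partial_functional y)"
  have "\<exists>M\<in>?A. \<forall>X\<in>?A. M \<subseteq> X \<longrightarrow> X = M"
  proof (rule subset_Zorn_nonempty)
    \<comment> \<open>Starting graph: the integer multiples of \<open>(y, 1)\<close>, single-valued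
      because \<open>y\<close> has infinite order.\<close>
    define G where "G = {(nat_mult m y - nat_mult n y, real m - real n) | m n. True}"
    have GI: "(nat_mult m y - nat_mult n y, real m - real n) \<in> G" for m n
      unfolding G_def by blast
    have "is_partial_functional y G"
      unfolding is_partial_functional_def
    proof (intro conjI allI impI)
      show "(y, 1) \<in> G" using GI[of 1 0] by simp
    next
      fix r assume "(0, r) \<in> G"
      then obtain m n where mn: "nat_mult m y = nat_mult n y" "r = real m - real n"
        unfolding G_def by auto
      have "m = n"
        using mn(1) nat_mult_eq_0_iff[OF assms, of "m - n"] nat_mult_eq_0_iff[OF assms, of "n - m"]
          nat_mult_add_left[of "m - n" n y] nat_mult_add_left[of "n - m" m y]
        by (cases "m \<le> n") auto
      then show "r = 0" using mn by simp
    next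
      fix a r b s assume "(a, r) \<in> G" "(b, s) \<in> G"
      then obtain m n m' n' where "a = nat_mult m y - nat_mult n y" "r = real m - real n"
        "b = nat_mult m' y - nat_mult n' y" "s = real m' - real n'"
        unfolding G_def by auto
      then have "a - b = nat_mult (m + n') y - nat_mult (n + m') y"
        "r - s = real (m + n') - real (n + m')"
        by (simp_all only: nat_mult_add_left of_nat_add) (simp_all add: algebra_simps)
      then show "(a - b, r - s) \<in> G" using GI by metis
    qed
    then show "?A \<noteq> {}" by blast
  next
    fix \<C> assume ne: "\<C> \<noteq> {}" and ch: "subset.chain ?A \<C>"
    have sub: "\<And>X. X \<in> \<C> \<Longrightarrow> is_partial_functional y X"
      and lin: "\<And>X Y. X \<in> \<C> \<Longrightarrow> Y \<in> \<C> \<Longrightarrow> X \<subseteq> Y \<or> Y \<subseteq> X"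
      using ch unfolding subset_chain_def by blast+
    have "is_partial_functional y (\<Union>\<C>)"
      unfolding is_partial_functional_def
    proof (intro conjI allI impI)
      show "(y, 1) \<in> \<Union>\<C>" using ne sub unfolding is_partial_functional_def by blast
      show "r = 0" if "(0, r) \<in> \<Union>\<C>" for r
        using that sub unfolding is_partial_functional_def by blast
      show "(a - b, r - s) \<in> \<Union>\<C>" if ab: "(a, r) \<in> \<Union>\<C>" "(b, s) \<in> \<Union>\<C>" for a r b s
      proof -
        obtain X Y where "X \<in> \<C>" "(a, r) \<in> X" "Y \<in> \<C>" "(b, s) \<in> Y" using ab by blast
        then obtain Z where "Z \<in> \<C>" "(a, r) \<in> Z" "(b, s) \<in> Z" using lin[of X Y] by blast
        then show ?thesis using partial_functional_diff[OF sub] by blast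
      qed
    qed
    then show "\<Union>\<C> \<in> ?A" by simp
  qed
  then obtain M where M: "is_partial_functional y M"
    and max: "\<And>X. is_partial_functional y X \<Longrightarrow> M \<subseteq> X \<Longrightarrow> X = M" by auto
  have "\<exists>s. (x, s) \<in> M" for x
    using partial_functional_extend[OF M, of x] max by blast
  then obtain f where f: "\<And>x. (x, f x) \<in> M" by metis
  show ?thesis
  proof
    show "\<forall>a b. f (a + b) = f a + f b"
      using partial_functional_unique[OF M f partial_functional_add[OF M f f]] by blast
    show "f y = 1"
      using partial_functional_unique[OF M f] M unfolding is_partial_functional_def by blast
  qed
qed

section \<open>Homogeneous elements\<close>

text \<open>Lets facts about positive monomials be reused for negative ones by substituting the
  family of adjoints.\<close>

lemma neg_monomial_eq: "neg_monomial \<iota> W = pos_monomial \<iota> (\<lambda>y. cstar (W y))"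
  by (intro ext) (simp add: neg_monomial_def pos_monomial_def)

lemma neg_quasi_monomial_eq: "neg_quasi_monomial \<iota> W = pos_quasi_monomial \<iota> (\<lambda>y. cstar (W y))"
  by (intro ext) (simp add: neg_quasi_monomial_def pos_quasi_monomial_def neg_monomial_eq)

lemma pos_quasi_monomial_zero: "pos_quasi_monomial \<iota> W x 0"
  unfolding pos_quasi_monomial_def by (rule exI[of _ "[]"]) simp

lemma pos_quasi_monomial_add:
  assumes "pos_quasi_monomial \<iota> W x p" "pos_quasi_monomial \<iota> W x q"
  shows "pos_quasi_monomial \<iota> W x (p + q)"
proof -
  obtain ms ns where "\<forall>m\<in>set ms. pos_monomial \<iota> W x m" "p = sum_list ms"
    "\<forall>m\<in>set ns. pos_monomial \<iota> W x m" "q = sum_list ns"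
    using assms unfolding pos_quasi_monomial_def by blast
  then show ?thesis
    unfolding pos_quasi_monomial_def by (intro exI[of _ "ms @ ns"]) auto
qed

lemma pos_monomial_imp_quasi: "pos_monomial \<iota> W x m \<Longrightarrow> pos_quasi_monomial \<iota> W x m"
  unfolding pos_quasi_monomial_def by (rule exI[of _ "[m]"]) simp

lemma pos_quasi_monomial_induct [consumes 1, case_names zero add]:
  assumes "pos_quasi_monomial \<iota> W x q"
    and zero: "P 0" and add: "\<And>m q. pos_monomial \<iota> W x m \<Longrightarrow> P q \<Longrightarrow> P (m + q)"
  shows "P q"
proof -
  obtain ms where "\<forall>m\<in>set ms. pos_monomial \<iota> W x m" "q = sum_list ms"
    using assms(1) unfolding pos_quasi_monomial_def by blast
  then show ?thesis
    by (induction ms arbitrary: q) (simp_all add: zero add)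
qed

text \<open>The normal form of a component of degree \<open>y\<close>, chosen to match the summands
  of \<open>E0_presentation\<close>.\<close>

definition graded :: "('a::cstar_algebra \<Rightarrow> 'x::cstar_algebra) \<Rightarrow> ('g::linordered_ab_group_add \<Rightarrow> 'x)
    \<Rightarrow> 'g \<Rightarrow> 'x \<Rightarrow> bool" where
  "graded \<iota> W y q \<longleftrightarrow> (if 0 < y then pos_quasi_monomial \<iota> W y q
     else if y < 0 then neg_quasi_monomial \<iota> W (- y) q else q \<in> range \<iota>)"

lemma graded_pos: "0 < y \<Longrightarrow> graded \<iota> W y q \<longleftrightarrow> pos_quasi_monomial \<iota> W y q"
  by (simp add: graded_def)

lemma graded_neg: "0 < y \<Longrightarrow> graded \<iota> W (- y) q \<longleftrightarrow> neg_quasi_monomial \<iota> W y q"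
  by (auto simp: graded_def dest: order.asym)

lemma graded_star_swap: "graded \<iota> (\<lambda>x. cstar (W x)) (- y) q \<longleftrightarrow> graded \<iota> W y q"
  by (auto simp: graded_def neg_quasi_monomial_eq cstar_cstar)

text \<open>Closed under products by construction, with no prescribed shape of words;
  \<open>homogeneous_graded\<close> recovers the normal form.\<close>

inductive homogeneous :: "('a::cstar_algebra \<Rightarrow> 'x::cstar_algebra) \<Rightarrow> ('g::linordered_ab_group_add \<Rightarrow> 'x)
    \<Rightarrow> 'g \<Rightarrow> 'x \<Rightarrow> bool" for \<iota> W where
  iota: "homogeneous \<iota> W 0 (\<iota> a)"
| gen: "0 \<le> z \<Longrightarrow> homogeneous \<iota> W z (W z)"
| gen_star: "0 \<le> z \<Longrightarrow> homogeneous \<iota> W (- z) (cstar (W z))"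
| mult: "homogeneous \<iota> W x p \<Longrightarrow> homogeneous \<iota> W y q \<Longrightarrow> homogeneous \<iota> W (x + y) (p * q)"
| add: "homogeneous \<iota> W x p \<Longrightarrow> homogeneous \<iota> W x q \<Longrightarrow> homogeneous \<iota> W x (p + q)"

text \<open>\<open>T\<close> only bounds the degrees, and a degree may occur repeatedly, which keeps
  sums and products easy; \<open>homogeneous_sum_imp_sum\<close> collects one component per
  degree.\<close>

inductive homogeneous_sum :: "('a::cstar_algebra \<Rightarrow> 'x::cstar_algebra)
    \<Rightarrow> ('g::linordered_ab_group_add \<Rightarrow> 'x) \<Rightarrow> 'g set \<Rightarrow> 'x \<Rightarrow> bool" for \<iota> W T where
  zero: "homogeneous_sum \<iota> W T 0"
| step: "y \<in> T \<Longrightarrow> homogeneous \<iota> W y q \<Longrightarrow> homogeneous_sum \<iota> W T b \<Longrightarrow> homogeneous_sum \<iota> W T (q + b)"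

lemma homogeneous_sum_single: "homogeneous \<iota> W y q \<Longrightarrow> y \<in> T \<Longrightarrow> homogeneous_sum \<iota> W T q"
  using homogeneous_sum.step[OF _ _ homogeneous_sum.zero, of y T \<iota> W q] by simp

lemma homogeneous_sum_add:
  "homogeneous_sum \<iota> W T b \<Longrightarrow> homogeneous_sum \<iota> W T c \<Longrightarrow> homogeneous_sum \<iota> W T (b + c)"
  by (induction rule: homogeneous_sum.induct) (simp_all add: add.assoc homogeneous_sum.step)

lemma homogeneous_sum_mono: "homogeneous_sum \<iota> W T b \<Longrightarrow> T \<subseteq> T' \<Longrightarrow> homogeneous_sum \<iota> W T' b"
  by (induction rule: homogeneous_sum.induct) (auto intro: homogeneous_sum.intros)

lemma homogeneous_sum_mult:
  assumes "homogeneous_sum \<iota> W T b" "homogeneous_sum \<iota> W T' c"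
    and "\<And>x y. x \<in> T \<Longrightarrow> y \<in> T' \<Longrightarrow> x + y \<in> T''"
  shows "homogeneous_sum \<iota> W T'' (b * c)"
  using assms(1)
proof (induction rule: homogeneous_sum.induct)
  case (step x p b)
  have "homogeneous_sum \<iota> W T'' (p * c)"
    using assms(2)
  proof (induction rule: homogeneous_sum.induct)
    case (step y q c)
    then show ?case
      using homogeneous.mult[OF \<open>homogeneous \<iota> W x p\<close> step(2)] assms(3)[OF \<open>x \<in> T\<close> step(1)]
      by (simp add: distrib_left homogeneous_sum.step)
  qed (simp add: homogeneous_sum.zero)
  then show ?case using step by (simp add: distrib_right homogeneous_sum_add)
qed (simp add: homogeneous_sum.zero)

text \<open>Contains all sums of \<open>k\<close> elements of a finite \<open>S\<close>: by
  commutativity only multiplicities matter, and each is at most \<open>k\<close>. This bounds the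
  size by (k + 1)^card S, polynomial in \<open>k\<close>.\<close>

definition sumset :: "'g::ab_group_add set \<Rightarrow> nat \<Rightarrow> 'g set" where
  "sumset S k = (\<lambda>n. \<Sum>s\<in>S. nat_mult (n s) s) ` (S \<rightarrow>\<^sub>E {0..k})"

lemma finite_sumset: "finite S \<Longrightarrow> finite (sumset S k)"
  unfolding sumset_def by (intro finite_imageI finite_PiE) auto

lemma card_sumset_le:
  assumes "finite S"
  shows "card (sumset S k) \<le> (k + 1) ^ card S"
proof -
  have "card (sumset S k) \<le> card (S \<rightarrow>\<^sub>E {0..k})"
    unfolding sumset_def by (intro card_image_le finite_PiE assms) auto
  also have "\<dots> = (k + 1) ^ card S"
    by (simp add: card_PiE[OF assms])
  finally show ?thesis .
qed

lemma zero_in_sumset: "0 \<in> sumset S k"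
proof -
  have "0 = (\<Sum>s\<in>S. nat_mult ((\<lambda>s\<in>S. 0) s) s)" by simp
  then show ?thesis
    unfolding sumset_def by (intro image_eqI[of _ _ "\<lambda>s\<in>S. 0"]) auto
qed

lemma add_in_sumset:
  assumes "finite S" "s \<in> S" "x \<in> sumset S k"
  shows "s + x \<in> sumset S (Suc k)"
proof -
  obtain n where n: "n \<in> S \<rightarrow>\<^sub>E {0..k}" "x = (\<Sum>s\<in>S. nat_mult (n s) s)"
    using assms(3) unfolding sumset_def by blast
  have "s + x = (\<Sum>t\<in>S. nat_mult ((n(s := Suc (n s))) t) t)"
    unfolding n(2) sum.remove[OF assms(1,2)] by (simp add: add.assoc cong: sum.cong_simp)
  moreover have "n(s := Suc (n s)) \<in> S \<rightarrow>\<^sub>E {0..Suc k}"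
    using n(1) assms(2) by (auto simp: PiE_iff extensional_def le_SucI)
  ultimately show ?thesis unfolding sumset_def by (rule image_eqI)
qed

section \<open>Normal forms under the crossed product relations\<close>

locale crossed_relations =
  fixes V H :: "'g::linordered_ab_group_add \<Rightarrow> 'a::cstar_algebra \<Rightarrow> 'a"
    and \<iota> :: "'a \<Rightarrow> 'x::cstar_algebra" and W :: "'g \<Rightarrow> 'x"
  assumes rel: "cp_relations V H \<iota> W" and V_0: "V 0 = id" and H_0: "H 0 = id"
begin

lemma iota_hom: "unital_star_hom \<iota>"
  and W_iota_Wstar: "0 \<le> x \<Longrightarrow> W x * \<iota> a * cstar (W x) = \<iota> (V x a)"
  and Wstar_iota_W: "0 \<le> x \<Longrightarrow> cstar (W x) * \<iota> a * W x = \<iota> (H x a)"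
  and W_mult: "0 \<le> x \<Longrightarrow> 0 \<le> y \<Longrightarrow> W x * W y = W (x + y)"
  and W_partial_isometry: "0 \<le> x \<Longrightarrow> W x * cstar (W x) * W x = W x"
  using rel by (simp_all add: cp_relations_def partial_isometry_def)

lemmas iota_simps = star_hom_one[OF iota_hom] star_hom_zero[OF iota_hom]

text \<open>The relations are symmetric under \<open>V \<leftrightarrow> H\<close>, \<open>W \<leftrightarrow> W\<^sup>*\<close>, which exchanges positive and negative
  monomials.\<close>

lemma star_swap: "crossed_relations H V \<iota> (\<lambda>x. cstar (W x))"
proof
  have "cstar (W x) * W x * cstar (W x) = cstar (W x)" if "0 \<le> x" for x
    using arg_cong[OF W_partial_isometry[OF that], of cstar]
    by (simp add: cstar_mult cstar_cstar mult.assoc)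
  then show "cp_relations H V \<iota> (\<lambda>x. cstar (W x))"
    unfolding cp_relations_def partial_isometry_def
    by (simp add: iota_hom W_iota_Wstar Wstar_iota_W cstar_cstar W_mult add.commute
        flip: cstar_mult)
qed (simp_all add: V_0 H_0)

text \<open>\<open>V 0 = id\<close> gives \<open>W 0\<close> a right inverse and the semigroup law
  makes it idempotent.\<close>

lemma W_0: "W 0 = 1"
proof -
  have "W 0 * cstar (W 0) = 1"
    using W_iota_Wstar[of 0 1] by (simp add: V_0 iota_simps)
  then show ?thesis
    using W_mult[of 0 0] by (metis add_0 mult.assoc mult.right_neutral order_refl)
qed

lemma W_split: "0 \<le> z \<Longrightarrow> z \<le> x \<Longrightarrow> W x = W (x - z) * W z"
  using W_mult[of "x - z" z] by simp

lemma graded_zero: "graded \<iota> W y 0"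
  using iota_simps(2)[symmetric]
  by (auto simp: graded_def neg_quasi_monomial_eq pos_quasi_monomial_zero)

lemma graded_add: "graded \<iota> W y p \<Longrightarrow> graded \<iota> W y q \<Longrightarrow> graded \<iota> W y (p + q)"
  by (auto simp: graded_def neg_quasi_monomial_eq pos_quasi_monomial_add
      simp flip: star_hom_add[OF iota_hom] split: if_splits)

lemma pos_monomial_mult_left:
  assumes "pos_monomial \<iota> W x m" "0 \<le> z"
  shows "pos_monomial \<iota> W (z + x) (\<iota> a * W z * m)"
proof -
  obtain ps where "ps \<noteq> []" "\<forall>p\<in>set ps. 0 \<le> snd p" "sum_list (map snd ps) = x"
    "m = prod_list (map (\<lambda>(a, y). \<iota> a * W y) ps)"
    using assms(1) unfolding pos_monomial_def by blast
  then show ?thesis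
    unfolding pos_monomial_def using assms(2) by (intro exI[of _ "(a, z) # ps"]) auto
qed

lemma pos_quasi_monomial_mult_left:
  assumes "pos_quasi_monomial \<iota> W x q" "0 \<le> z"
  shows "pos_quasi_monomial \<iota> W (z + x) (\<iota> a * W z * q)"
  using assms(1)
proof (induction rule: pos_quasi_monomial_induct)
  case (add m q)
  then show ?case
    using pos_monomial_mult_left[OF add(1) assms(2)]
    by (simp add: distrib_left pos_quasi_monomial_add pos_monomial_imp_quasi)
qed (simp add: pos_quasi_monomial_zero)

text \<open>By totality of the order, \<open>z\<close> is comparable with the first degree
  \<open>x\<close> of the word. If \<open>x \<le> z\<close>, covariance absorbs
  \<open>cstar (W x)\<close> and leaves \<open>W (z - x)\<close>; otherwise \<open>W z\<close> is
  absorbed and a negative monomial remains. The coefficient \<open>c\<close> is general because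
  absorption produces \<open>V x (c * a)\<close>.\<close>

lemma graded_W_neg_word:
  assumes "0 \<le> z" "\<forall>p\<in>set ps. 0 \<le> snd p"
  shows "graded \<iota> W (z - sum_list (map snd ps))
    (W z * \<iota> c * prod_list (map (\<lambda>(a, y). \<iota> a * cstar (W y)) ps))"
  using assms
proof (induction ps arbitrary: z c)
  case Nil
  show ?case
  proof (cases "z = 0")
    case False
    \<comment> \<open>Monomials carry coefficients on the left of the generators, so
      \<open>c\<close> enters through the letter \<open>(c, 0)\<close>, using
      \<open>W 0 = 1\<close>.\<close>
    have "pos_monomial \<iota> W z (W z * \<iota> c)"
      unfolding pos_monomial_def using Nil(1)
      by (intro exI[of _ "[(1, z), (c, 0)]"]) (simp add: iota_simps W_0)
    then show ?thesis
      using False Nil(1) by (simp add: graded_def pos_monomial_imp_quasi)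
  qed (simp add: graded_def W_0)
next
  case (Cons p ps)
  obtain a x where p: "p = (a, x)" by (cases p)
  have x: "0 \<le> x" and ps: "\<forall>p\<in>set ps. 0 \<le> snd p" using Cons.prems by (simp_all add: p)
  define N where "N = prod_list (map (\<lambda>(a, y). \<iota> a * cstar (W y)) ps)"
  have word: "W z * \<iota> c * prod_list (map (\<lambda>(a, y). \<iota> a * cstar (W y)) (p # ps))
      = W z * \<iota> (c * a) * cstar (W x) * N"
    by (simp add: p N_def star_hom_mult[OF iota_hom] mult.assoc)
  show ?case
  proof (cases "x \<le> z")
    case True
    have "W z * \<iota> (c * a) * cstar (W x) = W (z - x) * (W x * \<iota> (c * a) * cstar (W x))"
      by (simp add: W_split[OF x True] mult.assoc)
    then have "W z * \<iota> (c * a) * cstar (W x) = W (z - x) * \<iota> (V x (c * a))"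
      by (simp add: W_iota_Wstar[OF x])
    then show ?thesis
      unfolding word using Cons.IH[of "z - x" "V x (c * a)"] True ps
      by (simp add: N_def p algebra_simps)
  next
    case False
    have "cstar (W x) = cstar (W z) * cstar (W (x - z))"
      using W_split[of z x] Cons.prems(1) False by (simp flip: cstar_mult)
    then have "W z * \<iota> (c * a) * cstar (W x)
        = W z * \<iota> (c * a) * cstar (W z) * cstar (W (x - z))"
      by (simp add: mult.assoc)
    then have w: "W z * \<iota> (c * a) * cstar (W x) = \<iota> (V z (c * a)) * cstar (W (x - z))"
      by (simp add: W_iota_Wstar[OF Cons.prems(1)])
    \<comment> \<open>The degree must be strictly positive, since in degree 0 \<open>graded\<close>
      demands an element of \<open>range \<iota>\<close>.\<close>
    have "0 \<le> sum_list (map snd ps)"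
      using ps by (intro sum_list_nonneg) auto
    then have deg: "0 < x - z + sum_list (map snd ps)"
      using False by (simp add: add_pos_nonneg)
    have "neg_monomial \<iota> W (x - z + sum_list (map snd ps))
        (\<iota> (V z (c * a)) * cstar (W (x - z)) * N)"
      unfolding neg_monomial_def N_def using ps False
      by (intro exI[of _ "(V z (c * a), x - z) # ps"]) auto
    then have "neg_quasi_monomial \<iota> W (x - z + sum_list (map snd ps))
        (\<iota> (V z (c * a)) * cstar (W (x - z)) * N)"
      unfolding neg_quasi_monomial_eq neg_monomial_eq by (rule pos_monomial_imp_quasi)
    then have "graded \<iota> W (- (x - z + sum_list (map snd ps)))
        (\<iota> (V z (c * a)) * cstar (W (x - z)) * N)"
      by (simp only: graded_neg[OF deg])
    moreover have "z - sum_list (map snd (p # ps)) = - (x - z + sum_list (map snd ps))"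
      by (simp add: p)
    ultimately show ?thesis
      unfolding word w by (simp only:)
  qed
qed

lemma graded_W_mult:
  assumes z: "0 \<le> z" and q: "graded \<iota> W y q"
  shows "graded \<iota> W (z + y) (W z * q)"
proof -
  consider "0 < y" | "y = 0" | "y < 0" by force
  then show ?thesis
  proof cases
    case 1
    then have "pos_quasi_monomial \<iota> W (z + y) (W z * q)"
      using pos_quasi_monomial_mult_left[of y q z 1] q z by (simp add: graded_def iota_simps)
    then show ?thesis using 1 z by (simp add: graded_def add_nonneg_pos)
  next
    case 2
    then obtain a where "q = \<iota> a" using q by (auto simp: graded_def)
    then show ?thesis using graded_W_neg_word[OF z, of "[]" a] 2 by simp
  next
    case 3
    then have "pos_quasi_monomial \<iota> (\<lambda>y. cstar (W y)) (- y) q"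
      using q by (auto simp: graded_def neg_quasi_monomial_eq split: if_splits)
    then show ?thesis
    proof (induction rule: pos_quasi_monomial_induct)
      case (add m q)
      obtain ps where "\<forall>p\<in>set ps. 0 \<le> snd p" "sum_list (map snd ps) = - y"
        "m = prod_list (map (\<lambda>(a, y). \<iota> a * cstar (W y)) ps)"
        using add(1) unfolding pos_monomial_def by blast
      then have "graded \<iota> W (z + y) (W z * m)"
        using graded_W_neg_word[OF z, of ps 1] by (simp add: iota_simps)
      then show ?case using add(2) by (simp add: distrib_left graded_add)
    qed (simp add: graded_zero)
  qed
qed

lemma graded_Wstar_mult:
  assumes "0 \<le> z" "graded \<iota> W y q"
  shows "graded \<iota> W (- z + y) (cstar (W z) * q)"
proof -
  have "graded \<iota> (\<lambda>x. cstar (W x)) (- y) q"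
    using assms(2) by (simp only: graded_star_swap)
  from crossed_relations.graded_W_mult[OF star_swap assms(1) this]
  have "graded \<iota> (\<lambda>x. cstar (W x)) (- (- z + y)) (cstar (W z) * q)" by simp
  then show ?thesis by (simp only: graded_star_swap)
qed

lemma graded_iota_mult:
  assumes "graded \<iota> W y q"
  shows "graded \<iota> W y (\<iota> a * q)"
  using assms pos_quasi_monomial_mult_left[of y q 0 a]
    crossed_relations.pos_quasi_monomial_mult_left[OF star_swap, of "- y" q 0 a]
  by (auto simp: graded_def neg_quasi_monomial_eq W_0 simp flip: star_hom_mult[OF iota_hom]
      split: if_splits)

text \<open>By induction on the left factor only generators have to be examined, and no two normal
  forms are ever multiplied. Acting on 1 in degree 0, this yields
  \<open>homogeneous_graded\<close>.\<close>

lemma homogeneous_graded_mult: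
  "homogeneous \<iota> W x p \<Longrightarrow> graded \<iota> W y q \<Longrightarrow> graded \<iota> W (x + y) (p * q)"
proof (induction arbitrary: y q rule: homogeneous.induct)
  case (mult x p x' p')
  then show ?case by (simp add: add.assoc mult.assoc)
qed (simp_all add: graded_iota_mult graded_W_mult graded_Wstar_mult[simplified] distrib_right
    graded_add)

lemma homogeneous_graded:
  assumes "homogeneous \<iota> W y q"
  shows "graded \<iota> W y q"
proof -
  have "graded \<iota> W 0 (\<iota> 1)" by (simp add: graded_def)
  from homogeneous_graded_mult[OF assms this] show ?thesis by (simp add: iota_simps)
qed

section \<open>Sums of homogeneous elements\<close>

lemma homogeneous_zero: "homogeneous \<iota> W y 0"
proof (cases "0 \<le> y")
  case True
  then show ?thesis
    using homogeneous.mult[OF homogeneous.gen[OF True] homogeneous.iota, of \<iota> W 0]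
    by (simp add: iota_simps)
next
  case False
  then show ?thesis
    using homogeneous.mult[OF homogeneous.gen_star[of "- y"] homogeneous.iota, of \<iota> W 0]
    by (simp add: iota_simps)
qed

lemma homogeneous_cscale: "homogeneous \<iota> W y q \<Longrightarrow> homogeneous \<iota> W y (cscale c q)"
  using homogeneous.mult[OF homogeneous.iota, of \<iota> W y q "cscale c 1"] cscale_eq_mult[of c q]
  by (simp add: star_hom_cscale[OF iota_hom] iota_simps)

lemma homogeneous_cstar: "homogeneous \<iota> W y q \<Longrightarrow> homogeneous \<iota> W (- y) (cstar q)"
proof (induction rule: homogeneous.induct)
  case (iota a)
  show ?case using homogeneous.iota[of \<iota> W "cstar a"] by (simp add: star_hom_cstar[OF iota_hom])
next
  case (mult x p y q)
  then show ?case
    using homogeneous.mult[OF mult(4,3)] by (simp only: cstar_mult minus_add)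
qed (auto simp: cstar_cstar cstar_add intro: homogeneous.intros)

lemma homogeneous_in_C0: "homogeneous \<iota> W y q \<Longrightarrow> q \<in> C0 \<iota> W"
  unfolding C0_def
  by (induction rule: homogeneous.induct) (auto intro: star_subalg_gen.intros)

lemma homogeneous_sum_in_C0:
  "(\<And>y. y \<in> T \<Longrightarrow> homogeneous \<iota> W y (q y)) \<Longrightarrow> (\<Sum>y\<in>T. q y) \<in> C0 \<iota> W"
proof (induction T rule: infinite_finite_induct)
  case (insert y T)
  then show ?case
    using homogeneous_in_C0[of y "q y"] unfolding C0_def by (simp add: star_subalg_gen.add)
qed (use homogeneous_in_C0[OF homogeneous_zero] in auto)

lemma homogeneous_sum_cstar:
  "homogeneous_sum \<iota> W T b \<Longrightarrow> homogeneous_sum \<iota> W (uminus ` T) (cstar b)"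
  by (induction rule: homogeneous_sum.induct)
    (auto simp: cstar_add intro: homogeneous_sum.intros homogeneous_cstar)

lemma homogeneous_sum_imp_sum:
  assumes "homogeneous_sum \<iota> W T b" "finite T"
  shows "\<exists>q. (\<forall>y. homogeneous \<iota> W y (q y)) \<and> b = (\<Sum>y\<in>T. q y)"
  using assms(1)
proof (induction rule: homogeneous_sum.induct)
  case zero
  show ?case by (intro exI[of _ "\<lambda>_. 0"]) (simp add: homogeneous_zero)
next
  case (step y p b)
  then obtain q where q: "\<forall>y. homogeneous \<iota> W y (q y)" "b = (\<Sum>y\<in>T. q y)" by blast
  have "p + b = (\<Sum>z\<in>T. (q(y := p + q y)) z)"
    unfolding q(2) sum.remove[OF assms(2) step(1)] by (simp add: add.assoc cong: sum.cong_simp)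
  moreover have "\<forall>z. homogeneous \<iota> W z ((q(y := p + q y)) z)"
    using q(1) step(2) by (auto intro: homogeneous.add)
  ultimately show ?case by blast
qed

lemma C0_imp_homogeneous_sum:
  assumes "b \<in> C0 \<iota> W"
  shows "\<exists>T. finite T \<and> homogeneous_sum \<iota> W T b"
  using assms unfolding C0_def
proof (induction rule: star_subalg_gen.induct)
  case (gen s)
  then obtain y where "homogeneous \<iota> W y s" by (auto intro: homogeneous.intros)
  then show ?case by (intro exI[of _ "{y}"]) (auto intro: homogeneous_sum_single)
next
  case one
  show ?case
    using homogeneous_sum_single[OF homogeneous.iota[of \<iota> W 1], of "{0}"]
    by (intro exI[of _ "{0}"]) (simp add: iota_simps)
next
  case (add x y)
  then obtain T T' where "finite T" "homogeneous_sum \<iota> W T x" "finite T'" "homogeneous_sum \<iota> W T' y"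
    by blast
  then show ?case
    by (intro exI[of _ "T \<union> T'"])
      (auto intro!: homogeneous_sum_add elim: homogeneous_sum_mono)
next
  case (mult x y)
  then obtain T T' where T: "finite T" "homogeneous_sum \<iota> W T x" "finite T'" "homogeneous_sum \<iota> W T' y"
    by blast
  then have "homogeneous_sum \<iota> W ((\<lambda>(s, t). s + t) ` (T \<times> T')) (x * y)"
    by (intro homogeneous_sum_mult[OF T(2,4)]) force
  moreover have "finite ((\<lambda>(s, t). s + t) ` (T \<times> T'))" using T by simp
  ultimately show ?case by blast
next
  case (scal x c)
  then obtain T where T: "finite T" "homogeneous_sum \<iota> W T x" by blast
  have "homogeneous_sum \<iota> W {0} (\<iota> (cscale c 1))"
    by (rule homogeneous_sum_single[OF homogeneous.iota]) simp
  from homogeneous_sum_mult[OF this T(2), of T] have "homogeneous_sum \<iota> W T (cscale c x)"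
    using cscale_eq_mult[of c x] by (simp add: star_hom_cscale[OF iota_hom] iota_simps)
  then show ?case using T by blast
next
  case (star x)
  then obtain T where "finite T" "homogeneous_sum \<iota> W T x" by blast
  then show ?case using homogeneous_sum_cstar[of T x] by (intro exI[of _ "uminus ` T"]) simp
qed

lemma homogeneous_sum_power:
  assumes "finite S" "homogeneous_sum \<iota> W S a"
  shows "homogeneous_sum \<iota> W (sumset S k) (a ^ k)"
proof (induction k)
  case 0
  show ?case
    using homogeneous_sum_single[OF homogeneous.iota[of \<iota> W 1] zero_in_sumset]
    by (simp add: iota_simps)
next
  case (Suc k)
  then show ?case
    by (simp, intro homogeneous_sum_mult[OF assms(2)]) (auto intro: add_in_sumset[OF assms(1)])
qed

section \<open>Presentations and sums indexed by degree\<close>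

lemma E0_presentation_of_sum:
  assumes T: "finite T" "0 \<in> T" and q: "\<And>y. homogeneous \<iota> W y (q y)" and q0: "q 0 = \<iota> b0"
  shows "E0_presentation \<iota> W (\<Sum>y\<in>T. q y) b0"
proof -
  \<comment> \<open>A presentation uses one set of positive degrees for both types, so
    \<open>F\<close> collects the degrees occurring with either sign, and absent components are set
    to 0.\<close>
  define F where "F = {x. 0 < x \<and> (x \<in> T \<or> - x \<in> T)}"
  define qp where "qp x = (if x \<in> T then q x else 0)" for x
  define qn where "qn x = (if - x \<in> T then q (- x) else 0)" for x
  have "F \<subseteq> T \<union> uminus ` T" unfolding F_def by force
  then have F: "finite F" using T finite_subset by blast
  have pos: "(\<Sum>x\<in>F. qp x) = (\<Sum>x\<in>{x\<in>T. 0 < x}. q x)"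
    unfolding qp_def by (rule sum.mono_neutral_cong_right) (use F in \<open>auto simp: F_def\<close>)
  have "(\<Sum>x\<in>F. qn x) = (\<Sum>x\<in>{x. 0 < x \<and> - x \<in> T}. q (- x))"
    unfolding qn_def by (rule sum.mono_neutral_cong_right) (use F in \<open>auto simp: F_def\<close>)
  also have "\<dots> = (\<Sum>x\<in>{x\<in>T. x < 0}. q x)"
    by (rule sum.reindex_bij_witness[of _ uminus uminus]) auto
  finally have neg: "(\<Sum>x\<in>F. qn x) = (\<Sum>x\<in>{x\<in>T. x < 0}. q x)" .
  have "T = ({x\<in>T. x < 0} \<union> {0}) \<union> {x\<in>T. 0 < x}" using T by force
  then have "(\<Sum>y\<in>T. q y) = (\<Sum>y\<in>({x\<in>T. x < 0} \<union> {0}) \<union> {x\<in>T. 0 < x}. q y)" by simp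
  also have "\<dots> = (\<Sum>x\<in>F. qn x) + \<iota> b0 + (\<Sum>x\<in>F. qp x)"
    unfolding pos neg using T by (subst sum.union_disjoint, auto)+ (simp add: q0 add.commute)
  finally have sum: "(\<Sum>y\<in>T. q y) = (\<Sum>x\<in>F. qn x) + \<iota> b0 + (\<Sum>x\<in>F. qp x)" .
  have "neg_quasi_monomial \<iota> W x (qn x) \<and> pos_quasi_monomial \<iota> W x (qp x)" if "0 < x" for x
    using homogeneous_graded[OF q, of x] homogeneous_graded[OF q, of "- x"]
      graded_zero[of x] graded_zero[of "- x"]
    unfolding graded_pos[OF that] graded_neg[OF that] by (auto simp: qn_def qp_def)
  then show ?thesis
    unfolding E0_presentation_def using F sum
    by (intro exI[of _ F] exI[of _ qn] exI[of _ qp]) (auto simp: F_def)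
qed

lemma pos_monomial_homogeneous:
  assumes "pos_monomial \<iota> W x m"
  shows "homogeneous \<iota> W x m"
proof -
  have "homogeneous \<iota> W (sum_list (map snd ps)) (prod_list (map (\<lambda>(a, y). \<iota> a * W y) ps))"
    if "\<forall>p\<in>set ps. 0 \<le> snd p" for ps
    using that
  proof (induction ps)
    case Nil
    show ?case using homogeneous.iota[of \<iota> W 1] by (simp add: iota_simps)
  next
    case (Cons p ps)
    obtain a y where p: "p = (a, y)" by (cases p)
    have "homogeneous \<iota> W (0 + y + sum_list (map snd ps))
        (\<iota> a * W y * prod_list (map (\<lambda>(a, y). \<iota> a * W y) ps))"
      using Cons by (intro homogeneous.intros) (auto simp: p)
    then show ?case by (simp add: p)
  qed
  then show ?thesis using assms unfolding pos_monomial_def by blast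
qed

lemma pos_quasi_monomial_homogeneous:
  "pos_quasi_monomial \<iota> W x q \<Longrightarrow> homogeneous \<iota> W x q"
  by (induction rule: pos_quasi_monomial_induct)
    (auto intro: homogeneous_zero homogeneous.add pos_monomial_homogeneous)

lemma homogeneous_star_swap:
  "homogeneous \<iota> (\<lambda>x. cstar (W x)) y q \<Longrightarrow> homogeneous \<iota> W (- y) q"
proof (induction rule: homogeneous.induct)
  case (mult x p y q)
  then show ?case using homogeneous.mult[OF mult(3,4)] by simp
next
  case (iota a)
  show ?case using homogeneous.iota[of \<iota> W a] by simp
qed (auto simp: cstar_cstar intro: homogeneous.intros)

lemma neg_quasi_monomial_homogeneous:
  "neg_quasi_monomial \<iota> W x q \<Longrightarrow> homogeneous \<iota> W (- x) q"
  unfolding neg_quasi_monomial_eq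
  by (rule homogeneous_star_swap) (rule crossed_relations.pos_quasi_monomial_homogeneous[OF star_swap])

lemma E0_presentation_imp_sum:
  assumes "E0_presentation \<iota> W b b0"
  obtains T q where "finite T" "0 \<notin> T" "\<forall>y. homogeneous \<iota> W y (q y)" "b = \<iota> b0 + (\<Sum>y\<in>T. q y)"
proof -
  obtain F qn qp where F: "finite F" "F \<subseteq> {x. 0 < x}"
    and qm: "\<And>x. x \<in> F \<Longrightarrow> neg_quasi_monomial \<iota> W x (qn x)" "\<And>x. x \<in> F \<Longrightarrow> pos_quasi_monomial \<iota> W x (qp x)"
    and b: "b = (\<Sum>x\<in>F. qn x) + \<iota> b0 + (\<Sum>x\<in>F. qp x)"
    using assms unfolding E0_presentation_def by blast
  define q where "q y = (if y \<in> F then qp y else if - y \<in> F then qn (- y) else 0)" for y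
  have q: "homogeneous \<iota> W y (q y)" for y
    using neg_quasi_monomial_homogeneous[OF qm(1), of "- y"] pos_quasi_monomial_homogeneous[OF qm(2), of y]
    by (simp add: q_def homogeneous_zero)
  have nF: "- x \<notin> F" if "x \<in> F" for x
  proof
    assume "- x \<in> F"
    then have "0 < - x" "0 < x" using F(2) that by blast+
    then show False by simp
  qed
  then have disj: "F \<inter> uminus ` F = {}" by auto
  have "(\<Sum>y\<in>F \<union> uminus ` F. q y) = (\<Sum>y\<in>F. q y) + (\<Sum>y\<in>uminus ` F. q y)"
    using F(1) disj by (intro sum.union_disjoint) auto
  also have "(\<Sum>y\<in>F. q y) = (\<Sum>x\<in>F. qp x)" by (rule sum.cong) (auto simp: q_def)
  also have "(\<Sum>y\<in>uminus ` F. q y) = (\<Sum>x\<in>F. qn x)"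
    by (rule sum.reindex_bij_witness[of _ uminus uminus]) (auto simp: q_def nF)
  finally have "b = \<iota> b0 + (\<Sum>y\<in>F \<union> uminus ` F. q y)" unfolding b by (simp add: ac_simps)
  moreover have "finite (F \<union> uminus ` F)" "0 \<notin> F \<union> uminus ` F" using F by auto
  ultimately show ?thesis using q that by blast
qed

end

section \<open>The gauge action\<close>

text \<open>A geometric sum whose ratio \<open>cis 1\<close> differs from 1 because 1 lies strictly
  between 0 and pi. The bound is independent of \<open>N\<close>, so it disappears in the
  average.\<close>

lemma norm_sum_cis_le:
  "cmod (\<Sum>n<N. cis (real n)) \<le> 2 / cmod (1 - cis 1)"
proof -
  have ne: "cis 1 \<noteq> 1"
  proof
    assume "cis 1 = 1"
    then have "sin 1 = (0::real)" by (simp add: complex_eq_iff)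
    then show False using sin_gt_zero[of 1] pi_gt3 by simp
  qed
  have "(\<Sum>n<N. cis (real n)) = (\<Sum>n<N. cis 1 ^ n)"
    by (simp add: Complex.DeMoivre)
  also have "\<dots> = (1 - cis 1 ^ N) / (1 - cis 1)"
    using sum_gp_strict[of "cis 1" N] ne by simp
  finally have "cmod (\<Sum>n<N. cis (real n)) = cmod (1 - cis 1 ^ N) / cmod (1 - cis 1)"
    by (simp add: norm_divide)
  moreover have "cmod (1 - cis 1 ^ N) \<le> 2"
    using norm_triangle_ineq4[of 1 "cis 1 ^ N"] by (simp add: norm_power)
  ultimately show ?thesis by (simp add: divide_right_mono)
qed

lemma le_of_nat_mult_le:
  fixes a b c :: real
  assumes "\<And>N::nat. real N * a \<le> real N * b + c"
  shows "a \<le> b"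
proof (rule ccontr)
  assume "\<not> a \<le> b"
  then obtain N where "c < real N * (a - b)" using reals_Archimedean3[of "a - b"] by auto
  then show False using assms[of N] by (simp add: algebra_simps)
qed

text \<open>Universality is taken with the crossed product itself as target, since the gauge maps
  are endomorphisms of it.\<close>

locale crossed_product = crossed_relations V H \<iota> W
  for V H :: "'g::linordered_ab_group_add \<Rightarrow> 'a::cstar_algebra \<Rightarrow> 'a"
    and \<iota> :: "'a \<Rightarrow> 'x::cstar_algebra" and W :: "'g \<Rightarrow> 'x" +
  assumes cp: "is_crossed_product TYPE('x) V H \<iota> W"
begin

text \<open>Twisting \<open>W x\<close> by the phase \<open>cis (f x)\<close> keeps the relations:
  the phases cancel in the covariance relations, and additivity of \<open>f\<close> preserves the
  semigroup law.\<close>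

lemma gauge_endomorphism:
  fixes f :: "'g \<Rightarrow> real"
  assumes f: "\<And>x y. f (x + y) = f x + f y"
  shows "\<exists>\<alpha>. unital_star_hom \<alpha> \<and>
    (\<forall>y q. homogeneous \<iota> W y q \<longrightarrow> \<alpha> q = cscale (cis (f y)) q)"
proof -
  define S where "S x = cscale (cis (f x)) (W x)" for x
  have star_S: "cstar (S x) = cscale (cis (- f x)) (cstar (W x))" for x
    by (simp add: S_def cstar_cscale cis_cnj)
  have S: "S x * b * cstar (S x) = W x * b * cstar (W x)"
    "cstar (S x) * b * S x = cstar (W x) * b * W x" for x b
    unfolding star_S unfolding S_def
    by (simp_all add: cscale_mult_left[symmetric] cscale_mult_right[symmetric] cscale_mult_scal
        cis_mult cscale_one)
  have cp_S: "cp_relations V H \<iota> S"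
    unfolding cp_relations_def partial_isometry_def
  proof (intro conjI allI impI iota_hom)
    fix x y :: 'g assume "0 \<le> x" "0 \<le> y"
    then show "S x * S y = S (x + y)"
      by (simp add: S_def cscale_mult_left[symmetric] cscale_mult_right[symmetric]
          cscale_mult_scal cis_mult W_mult f add.commute)
  next
    fix x :: 'g assume x: "0 \<le> x"
    have "S x * 1 * cstar (S x) * S x = W x * 1 * cstar (W x) * S x" by (simp only: S)
    also have "\<dots> = S x"
      using W_partial_isometry[OF x] by (simp add: S_def cscale_mult_right[symmetric])
    finally show "S x * cstar (S x) * S x = S x" by simp
  qed (simp_all add: S W_iota_Wstar Wstar_iota_W)
  obtain \<alpha> where \<alpha>: "unital_star_hom \<alpha>" "\<And>a. \<alpha> (\<iota> a) = \<iota> a" "\<And>x. 0 \<le> x \<Longrightarrow> \<alpha> (W x) = S x"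
  proof -
    have "\<forall>(\<pi> :: 'a \<Rightarrow> 'x) S. cp_relations V H \<pi> S \<longrightarrow>
        (\<exists>\<phi>. unital_star_hom \<phi> \<and> (\<forall>a. \<phi> (\<iota> a) = \<pi> a) \<and> (\<forall>x\<ge>0. \<phi> (W x) = S x))"
      using cp unfolding is_crossed_product_def by (elim conjE)
    from this[rule_format, OF cp_S] show ?thesis using that by auto
  qed
  have f0: "f 0 = 0" using f[of 0 0] by simp
  have fm: "f (- x) = - f x" for x using f[of x "- x"] f0 by simp
  have "\<alpha> q = cscale (cis (f y)) q" if "homogeneous \<iota> W y q" for y q
    using that
  proof (induction rule: homogeneous.induct)
    case (mult x p y q)
    then show ?case
      by (simp add: star_hom_mult[OF \<alpha>(1)] f cscale_mult_left[symmetric]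
          cscale_mult_right[symmetric] cscale_mult_scal cis_mult add.commute)
  qed (simp_all add: \<alpha> S_def star_S[unfolded S_def] f0 fm cscale_one star_hom_cstar[OF \<alpha>(1)]
      star_hom_add[OF \<alpha>(1)] cscale_add_right)
  with \<alpha>(1) show ?thesis by blast
qed

text \<open>Degrees are removed one at a time: summing over the gauge maps of \<open>n * f\<close>
  for \<open>n < N\<close>, with \<open>f y = 1\<close>, multiplies the component of degree
  \<open>y\<close> by a bounded scalar and that of degree 0 by \<open>N\<close>. The remaining
  components acquire scalar factors, so the induction is over arbitrary \<open>q\<close> and
  \<open>b0\<close>.\<close>

lemma norm_iota_le_norm_sum:
  assumes "finite T" "0 \<notin> T" "\<And>y. homogeneous \<iota> W y (q y)"
  shows "norm (\<iota> b0) \<le> norm (\<iota> b0 + (\<Sum>y\<in>T. q y))"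
  using assms
proof (induction T arbitrary: q b0 rule: finite_induct)
  case (insert y T)
  have "y \<noteq> 0" using insert.prems(1) by auto
  then obtain f :: "'g \<Rightarrow> real" where f_add: "\<forall>a b. f (a + b) = f a + f b" and fy: "f y = 1"
    by (rule exists_additive_functional)
  note f = f_add[rule_format] fy
  have f0: "f 0 = 0" using f(1)[of 0 0] by simp
  have "\<exists>\<alpha>. unital_star_hom \<alpha> \<and> (\<forall>y q. homogeneous \<iota> W y q \<longrightarrow> \<alpha> q = cscale (cis (real n * f y)) q)"
    for n :: nat
    by (rule gauge_endomorphism) (simp add: f distrib_left)
  then obtain \<alpha> where \<alpha>: "\<And>n::nat. unital_star_hom (\<alpha> n)"
    "\<And>n y q. homogeneous \<iota> W y q \<Longrightarrow> \<alpha> n q = cscale (cis (real n * f y)) q" by metis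
  let ?b = "\<iota> b0 + (\<Sum>z\<in>insert y T. q z)"
  define s where "s N z = (\<Sum>n<N. cis (real n * f z))" for N :: nat and z
  have avg: "(\<Sum>n<N. \<alpha> n ?b)
      = \<iota> (real N *\<^sub>R b0) + (\<Sum>z\<in>T. cscale (s N z) (q z)) + cscale (s N y) (q y)" for N
  proof -
    have "\<alpha> n ?b = \<iota> b0 + (\<Sum>z\<in>insert y T. cscale (cis (real n * f z)) (q z))" for n
      using \<alpha>(2)[OF homogeneous.iota[of \<iota> W b0]] \<alpha>(2)[OF insert.prems(2)]
      by (simp only: star_hom_add[OF \<alpha>(1)] star_hom_sum[OF \<alpha>(1)])
        (simp add: f0 cscale_one)
    then have "(\<Sum>n<N. \<alpha> n ?b)
        = real N *\<^sub>R \<iota> b0 + (\<Sum>z\<in>insert y T. \<Sum>n<N. cscale (cis (real n * f z)) (q z))"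
      using sum.swap[of "\<lambda>n z. cscale (cis (real n * f z)) (q z)" "insert y T" "{..<N}"]
      by (simp only: sum.distrib sum_constant_scaleR) simp
    also have "\<dots> = real N *\<^sub>R \<iota> b0 + (\<Sum>z\<in>insert y T. cscale (s N z) (q z))"
      by (simp only: s_def cscale_sum_left)
    finally show ?thesis
      using insert.hyps by (simp add: star_hom_scaleR[OF iota_hom] ac_simps)
  qed
  have "real N * norm (\<iota> b0) \<le> real N * norm ?b + 2 / cmod (1 - cis 1) * norm (q y)" for N
  proof -
    have "real N * norm (\<iota> b0) = norm (\<iota> (real N *\<^sub>R b0))"
      by (simp add: star_hom_scaleR[OF iota_hom])
    \<comment> \<open>The induction hypothesis is applied to \<open>N\<close> times
      \<open>b0\<close> and the rescaled components; division by \<open>N\<close> is left to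
      \<open>le_of_nat_mult_le\<close>.\<close>
    also have "\<dots> \<le> norm (\<iota> (real N *\<^sub>R b0) + (\<Sum>z\<in>T. cscale (s N z) (q z)))"
      using insert.prems by (intro insert.IH) (auto intro: homogeneous_cscale)
    also have "\<dots> = norm ((\<Sum>n<N. \<alpha> n ?b) - cscale (s N y) (q y))"
      unfolding avg by simp
    also have "\<dots> \<le> norm (\<Sum>n<N. \<alpha> n ?b) + norm (cscale (s N y) (q y))"
      by (rule norm_triangle_ineq4)
    also have "\<dots> \<le> real N * norm ?b + 2 / cmod (1 - cis 1) * norm (q y)"
    proof (rule add_mono)
      have "norm (\<Sum>n<N. \<alpha> n ?b) \<le> (\<Sum>n<N. norm ?b)"
        by (intro sum_norm_le star_hom_norm_le \<alpha>)
      then show "norm (\<Sum>n<N. \<alpha> n ?b) \<le> real N * norm ?b" by simp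
      show "norm (cscale (s N y) (q y)) \<le> 2 / cmod (1 - cis 1) * norm (q y)"
        unfolding norm_cscale s_def f(2) using norm_sum_cis_le[of N]
        by (intro mult_right_mono) simp_all
    qed
    finally show ?thesis .
  qed
  then show ?case by (rule le_of_nat_mult_le)
qed simp

lemma norm_iota_le_of_E0_presentation:
  assumes "E0_presentation \<iota> W b b0"
  shows "norm (\<iota> b0) \<le> norm b"
proof -
  obtain T q where "finite T" "0 \<notin> T" "\<forall>y. homogeneous \<iota> W y (q y)" "b = \<iota> b0 + (\<Sum>y\<in>T. q y)"
    using E0_presentation_imp_sum[OF assms] .
  then show ?thesis using norm_iota_le_norm_sum[of T q b0] by simp
qed

end

section \<open>Norm estimates from property (*)\<close>

lemma le_one_of_power_le_poly:
  fixes r :: real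
  assumes "\<And>n. r ^ (2 ^ n) \<le> (real (2 ^ n) + 1) ^ m"
  shows "r \<le> 1"
proof (rule ccontr)
  assume "\<not> r \<le> 1"
  \<comment> \<open>The root makes \<open>r ^ k\<close> the \<open>Suc m\<close>-th power of the
    square of \<open>s ^ k\<close>. The hypothesis then gives (s^k)^2 <= k + 1, whereas by
    Bernoulli's inequality the left side grows at least quadratically in \<open>k\<close>.\<close>
  define s where "s = root (2 * Suc m) r"
  define \<delta> where "\<delta> = s - 1"
  have s: "s > 1" "s ^ (2 * Suc m) = r"
    using \<open>\<not> r \<le> 1\<close> unfolding s_def by (simp_all del: mult_Suc_right mult_Suc)
  then have d: "\<delta> > 0" by (simp add: \<delta>_def)
  have le: "real (2 ^ n) * \<delta>\<^sup>2 \<le> 1" for n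
  proof -
    define k :: nat where "k = 2 ^ n"
    have k: "k > 0" by (simp add: k_def)
    have "((s ^ k)\<^sup>2) ^ Suc m = (s ^ (2 * Suc m)) ^ k"
      by (simp only: power_mult[symmetric] mult.assoc mult.commute[of k])
    also have "\<dots> \<le> (real k + 1) ^ m"
      using assms[of n] s(2) by (simp add: k_def)
    also have "\<dots> \<le> (real k + 1) ^ Suc m"
      by (rule power_increasing) simp_all
    finally have "(s ^ k)\<^sup>2 \<le> real k + 1"
      by (rule power_le_imp_le_base) simp
    moreover have "1 + real k * \<delta> \<le> s ^ k"
      using Bernoulli_inequality[of \<delta> k] d by (simp add: \<delta>_def)
    then have "(1 + real k * \<delta>)\<^sup>2 \<le> (s ^ k)\<^sup>2"
      using d by (intro power_mono) simp_all
    ultimately have "(1 + real k * \<delta>)\<^sup>2 \<le> real k + 1" by linarith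
    then have "real k * (real k * \<delta>\<^sup>2) \<le> real k * 1"
      using d by (simp add: power2_eq_square algebra_simps)
        (smt (verit) mult_nonneg_nonneg of_nat_0_le_iff)
    then show ?thesis using k by (simp add: k_def)
  qed
  obtain n where "1 / \<delta>\<^sup>2 < 2 ^ n" using real_arch_pow[of 2 "1 / \<delta>\<^sup>2"] by auto
  then show False using le[of n] d by (simp add: field_simps)
qed

context crossed_relations
begin

context
  fixes \<phi> :: "'x \<Rightarrow> 'c::cstar_algebra"
  assumes phi: "unital_star_hom \<phi>" and star: "property_star \<iota> W \<phi>"
begin

lemma norm_component_le:
  assumes T: "finite T" "y \<in> T" and q: "\<And>y. homogeneous \<iota> W y (q y)"
  shows "norm (q y) \<le> norm (\<phi> (\<Sum>y\<in>T. q y))"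
proof (cases "q y = 0")
  case False
  let ?b = "\<Sum>y\<in>T. q y"
  \<comment> \<open>The component of degree \<open>z\<close> of \<open>cstar (q y) * ?b\<close>; the
    shift moves degree \<open>y\<close> to 0.\<close>
  define p where "p z = cstar (q y) * q (z + y)" for z
  have p: "homogeneous \<iota> W z (p z)" for z
    using homogeneous.mult[OF homogeneous_cstar[OF q[of y]] q[of "z + y"]] by (simp add: p_def)
  obtain b0 where b0: "p 0 = \<iota> b0"
    using homogeneous_graded[OF p[of 0]] by (auto simp: graded_def)
  define T' where "T' = (\<lambda>z. z - y) ` T"
  have T': "finite T'" "0 \<in> T'" using T by (auto simp: T'_def)
  have sum: "(\<Sum>z\<in>T'. p z) = cstar (q y) * ?b"
    unfolding T'_def p_def sum_distrib_left by (subst sum.reindex) (auto simp: inj_on_def)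
  have "(\<Sum>z\<in>T'. p z) \<in> C0 \<iota> W" by (rule homogeneous_sum_in_C0) (rule p)
  then have "norm b0 \<le> norm (\<phi> (\<Sum>z\<in>T'. p z))"
    using star E0_presentation_of_sum[OF T' p b0] unfolding property_star_def by blast
  also have "\<dots> \<le> norm (\<phi> (cstar (q y))) * norm (\<phi> ?b)"
    unfolding sum star_hom_mult[OF phi] by (rule norm_mult_ineq)
  also have "\<dots> \<le> norm (q y) * norm (\<phi> ?b)"
    using star_hom_norm_le[OF phi, of "cstar (q y)"] by (intro mult_right_mono) simp_all
  \<comment> \<open>Since \<open>\<iota> b0\<close> equals \<open>cstar (q y) * q y\<close>, the
    C*-identity turns this into an estimate from which one factor \<open>norm (q y)\<close>
    cancels.\<close>
  finally have "norm (\<iota> b0) \<le> norm (q y) * norm (\<phi> ?b)"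
    using star_hom_norm_le[OF iota_hom, of b0] by linarith
  then have "norm (q y) * norm (q y) \<le> norm (q y) * norm (\<phi> ?b)"
    using cstar_identity[of "q y"] by (simp add: power2_eq_square p_def flip: b0)
  then show ?thesis using False by simp
qed simp

lemma norm_homogeneous_sum_le:
  assumes "finite T" "homogeneous_sum \<iota> W T b"
  shows "norm b \<le> real (card T) * norm (\<phi> b)"
proof -
  obtain q where q: "\<And>y. homogeneous \<iota> W y (q y)" "b = (\<Sum>y\<in>T. q y)"
    using homogeneous_sum_imp_sum[OF assms(2,1)] by blast
  have "norm b \<le> (\<Sum>y\<in>T. norm (\<phi> b))"
    unfolding q(2) by (rule sum_norm_le) (rule norm_component_le[OF assms(1) _ q(1)])
  then show ?thesis by simp
qed

text \<open>Both \<open>cstar b * b\<close> and its image are self-adjoint, so norms of their powers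
  \<open>2 ^ n\<close> are powers of their norms. The factor from
  \<open>norm_homogeneous_sum_le\<close> is polynomial in the exponent and is removed by
  \<open>le_one_of_power_le_poly\<close>.\<close>

lemma norm_le_on_C0:
  assumes b: "b \<in> C0 \<iota> W"
  shows "norm b \<le> norm (\<phi> b)"
proof (cases "b = 0")
  case False
  define a where "a = cstar b * b"
  have "a \<in> C0 \<iota> W"
    using b unfolding a_def C0_def by (intro star_subalg_gen.mult star_subalg_gen.star)
  then obtain S where S: "finite S" "homogeneous_sum \<iota> W S a"
    using C0_imp_homogeneous_sum by blast
  have sa: "cstar a = a" by (simp add: a_def cstar_mult cstar_cstar)
  then have sa': "cstar (\<phi> a) = \<phi> a" by (simp flip: star_hom_cstar[OF phi])
  have est: "norm a ^ (2 ^ n) \<le> (real (2 ^ n) + 1) ^ card S * norm (\<phi> a) ^ (2 ^ n)" for n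
  proof -
    have "norm a ^ (2 ^ n) = norm (a ^ (2 ^ n))"
      by (rule norm_power_selfadjoint[OF sa, symmetric])
    also have "\<dots> \<le> real (card (sumset S (2 ^ n))) * norm (\<phi> (a ^ (2 ^ n)))"
      by (intro norm_homogeneous_sum_le finite_sumset homogeneous_sum_power S)
    also have "norm (\<phi> (a ^ (2 ^ n))) = norm (\<phi> a) ^ (2 ^ n)"
      by (simp add: star_hom_power[OF phi] norm_power_selfadjoint[OF sa'])
    also have "real (card (sumset S (2 ^ n))) \<le> real ((2 ^ n + 1) ^ card S)"
      by (simp only: of_nat_le_iff card_sumset_le[OF S(1)])
    also have "real ((2 ^ n + 1) ^ card S) = (real (2 ^ n) + 1) ^ card S"
      by (simp add: add.commute)
    finally show ?thesis by (simp add: mult_right_mono)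
  qed
  have na: "norm a > 0" using False by (simp add: a_def cstar_identity)
  \<comment> \<open>The estimate for \<open>n = 0\<close> already rules out
    \<open>\<phi> a = 0\<close>, so the quotient of the norms can be formed.\<close>
  have pos: "norm (\<phi> a) > 0"
  proof (rule ccontr)
    assume "\<not> norm (\<phi> a) > 0"
    then have "norm (\<phi> a) = 0" by simp
    then show False using est[of 0] na by simp
  qed
  have "norm a / norm (\<phi> a) \<le> 1"
    by (rule le_one_of_power_le_poly[of _ "card S"]) (use est pos in \<open>simp add: power_divide divide_le_eq\<close>)
  then have "norm a \<le> norm (\<phi> a)" using pos by simp
  then have "(norm b)\<^sup>2 \<le> (norm (\<phi> b))\<^sup>2"
    by (simp add: a_def star_hom_mult[OF phi] star_hom_cstar[OF phi] cstar_identity)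
  then show ?thesis by (rule power2_le_imp_le) simp
qed simp

lemma inj_of_property_star:
  assumes dense: "closure (C0 \<iota> W) = UNIV"
  shows "inj \<phi>"
proof -
  have "closed {b. norm b \<le> norm (\<phi> b)}"
    by (intro closed_Collect_le continuous_intros
        linear_continuous_on[OF bounded_linear_star_hom[OF phi]])
  then have "closure (C0 \<iota> W) \<subseteq> {b. norm b \<le> norm (\<phi> b)}"
    using norm_le_on_C0 by (intro closure_minimal) auto
  then have ge: "norm b \<le> norm (\<phi> b)" for b using dense by auto
  show ?thesis
  proof (rule injI)
    fix b c assume "\<phi> b = \<phi> c"
    then have "norm (b - c) \<le> 0" using ge[of "b - c"] by (simp add: star_hom_diff[OF phi])
    then show "b = c" by simp
  qed
qed

end

end

section \<open>Equivalence of injectivity and the norm estimate\<close>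

theorem theorem5p4:
  fixes V H :: "'g::linordered_ab_group_add \<Rightarrow> 'a::cstar_algebra \<Rightarrow> 'a"
    and \<sigma> :: "'a \<Rightarrow> 'c::cstar_algebra" and U :: "'g \<Rightarrow> 'c"
    and \<iota> :: "'a \<Rightarrow> 'x::cstar_algebra" and W :: "'g \<Rightarrow> 'x"
    and \<phi> :: "'x \<Rightarrow> 'c"
  assumes V_action: "semigroup_action V"
    and H_action: "semigroup_action H"
    and cov: "covariant_rep V \<sigma> U"
    and H_assoc: "\<forall>x\<ge>0. \<forall>a. \<sigma> (H x a) = cstar (U x) * \<sigma> a * U x"
    and cp_c: "is_crossed_product TYPE('c) V H \<iota> W"
    and cp_x: "is_crossed_product TYPE('x) V H \<iota> W"
    and phi_hom: "unital_star_hom \<phi>"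
    and phi_iota: "\<forall>a. \<phi> (\<iota> a) = \<sigma> a"
    and phi_W: "\<forall>x\<ge>0. \<phi> (W x) = U x"
  shows "inj \<phi> \<longleftrightarrow> property_star \<iota> W \<phi>"
proof -
  interpret crossed_product V H \<iota> W
    using cp_x V_action H_action
    by unfold_locales (auto simp: is_crossed_product_def semigroup_action_def)
  show ?thesis
  proof
    assume inj: "inj \<phi>"
    have \<sigma>: "unital_star_hom \<sigma>" "inj \<sigma>"
      using cov by (simp_all add: covariant_rep_def)
    show "property_star \<iota> W \<phi>"
      unfolding property_star_def
    proof (intro ballI allI impI)
      fix b b0 assume "E0_presentation \<iota> W b b0"
      then have "norm (\<iota> b0) \<le> norm b" by (rule norm_iota_le_of_E0_presentation)
      \<comment> \<open>The bound of \<open>norm b0\<close> by \<open>norm (\<iota> b0)\<close>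
        comes from the injectivity of \<open>\<sigma>\<close>, which factors as
        \<open>\<phi>\<close> after \<open>\<iota>\<close>.\<close>
      moreover have "norm b0 \<le> norm (\<sigma> b0)" by (rule injective_star_hom_norm_ge[OF \<sigma>])
      moreover have "norm (\<sigma> b0) \<le> norm (\<iota> b0)"
        using star_hom_norm_le[OF phi_hom, of "\<iota> b0"] phi_iota by simp
      moreover have "norm b \<le> norm (\<phi> b)" by (rule injective_star_hom_norm_ge[OF phi_hom inj])
      ultimately show "norm b0 \<le> norm (\<phi> b)" by linarith
    qed
  next
    assume "property_star \<iota> W \<phi>"
    then show "inj \<phi>"
      using cp_x unfolding is_crossed_product_def
      by (intro inj_of_property_star[OF phi_hom]) (auto simp: C0_def)
  qed
qed

end
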